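(* Let $G$ be a countably infinite group and let $G\curvearrowright X$ be an expansive action of $G$ on a compact metrizable group $X$ (not necessarily abelian) by continuous automorphisms. The following hold: (1) If $\Delta(X,G)\neq\{e_X\}$, then $h^{\rm nv}_{\rm top}(G\curvearrowright X)>0$. (2) If $\Delta(X,G)$ is dense in $X$, then $G\curvearrowright X$ has naive UPE of all orders. Furthermore, if $G$ is sofic with $\Sigma$ a sofic approximation sequence for $G$, then: (1') If $\Delta(X,G)\neq\{e_X\}$, then $h^{\Sigma}_{\rm top}(G\curvearrowright X)>0$. (2') If $\Delta(X,G)$ is dense in $X$, then $G\curvearrowright X$ has sofic UPE of all orders (with respect to $\Sigma$).
   Context: Fix a compatible metric $d$ on $X$ (the notions below do not depend on its choice); $e_X$ is the identity of $X$. Expansive: there is $c>0$ such that for all $x\neq y$ in $X$ there is $g\in G$ with $d(gx,gy)>c$. Homoclinic group: $\Delta(X,G)=\{x\in X: sx\to e_X\text{ as }G\ni s\to\infty\}$. Naive topological entropy: $h^{\rm nv}_{\rm top}(G\curvearrowright X)=\sup_{\mathcal U}\inf_{\varnothing\neq F\subset G\text{ finite}}\frac1{|F|}\log N(\mathcal U^F)$, where $\mathcal U$ ranges over open covers, $\mathcal U^F=\bigvee_{g\in F}g^{-1}\mathcal U$ and $N(\cdot)$ is the minimal cardinality of a subcover. Orbit independence: for a tuple $\mathbf A=(A_1,\dots,A_k)$ of subsets of $X$, $J\subset G$ is an independence set for $\mathbf A$ if for every nonempty finite $I\subset J$ and every $\phi:I\to\{1,\dots,k\}$ we have $\bigcap_{s\in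 I}s^{-1}A_{\phi(s)}\neq\varnothing$. The independence density of $\mathbf A$ is the largest $q\ge0$ such that every finite $F\subset G$ has a subset of cardinality at least $q|F|$ which is an independence set for $\mathbf A$. $\mathrm{IE}_k(X,G)$ is the set of $(x_1,\dots,x_k)\in X^k$ such that for every product neighborhood $U_1\times\dots\times U_k$ of it the tuple $(U_1,\dots,U_k)$ has positive independence density. Naive UPE of all orders: $\mathrm{IE}_k(X,G)=X^k$ for all $k\ge2$. Sofic approximation sequence: $\Sigma=\{\sigma_i:G\to\mathrm{Sym}(n_i)\}_{i\in\mathbb{N}}$ with $n_i\to\infty$, such that $\frac1{n_i}|\{v:\sigma_i(st)v=\sigma_i(s)\sigma_i(t)v\}|\to1$ for all $s,t\in G$ and $\frac1{n_i}|\{v:\sigma_i(s)v\ne\sigma_i(t)v\}|\to1$ for all $s\neq t$. $G$ is sofic if it admits one. For finite $F\subset G$, $\delta>0$, $\sigma:G\to\mathrm{Sym}(n)$, $\mathrm{Map}(d,F,\delta,\sigma)$ is the set of maps $\varphi:\{1,\dots,n\}\to X$ with $\big(\frac1n\sum_{v=1}^n d(\varphi(\sigma(s)v),s\varphi(v))^2\big)^{1/2}\le\delta$ for every $s\in F$. $N_\varepsilon(Y,d_\infty)$ is the maximal cardinality of a subset of $Y\subset X^{\{1,\dots,n\}}$ whose distinct elements $\varphi_1,\varphi_2$ satisfy $\max_v d(\varphi_1(v),\varphi_2(v))\ge\varepsilon$. Sofic topological entropy: $h^\Sigma_{\rm top}(G\curvearrowright X)=\sup_{\varepsilon>0}\inf_{F\subset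 G\text{ finite}}\inf_{\delta>0}\limsup_{i\to\infty}\frac1{n_i}\log N_\varepsilon(\mathrm{Map}(d,F,\delta,\sigma_i),d_\infty)$ (with $\log 0=-\infty$). For a tuple $\mathbf A=(A_1,\dots,A_k)$ of subsets of $X$, $J\subset\{1,\dots,n\}$ is a $(d,F,\delta,\sigma)$-independence set for $\mathbf A$ if for every $\omega:J\to\{1,\dots,k\}$ there is $\varphi\in\mathrm{Map}(d,F,\delta,\sigma)$ with $\varphi(a)\in A_{\omega(a)}$ for all $a\in J$. $\mathbf A$ has positive upper independence density over $\Sigma$ if there is $q>0$ such that for every finite $F\subset G$ and $\delta>0$ there are infinitely many $i$ for which $\mathbf A$ has a $(d,F,\delta,\sigma_i)$-independence set of cardinality at least $qn_i$. $\mathrm{IE}^\Sigma_k(X,G)$ is the set of $k$-tuples in $X^k$ all of whose product neighborhoods $U_1\times\dots\times U_k$ are such that $(U_1,\dots,U_k)$ has positive upper independence density over $\Sigma$. Sofic UPE of all orders: $\mathrm{IE}^\Sigma_k(X,G)=X^k$ for all $k\ge2$. *)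

theory Defs
  imports
    "HOL-Algebra.Group_Action"
    "HOL-Analysis.Analysis"
    "HOL-Combinatorics.Permutations"
begin

section \<open>Actions by continuous automorphisms\<close>

locale topological_group = group X for X (structure) +
  fixes T
  assumes topspace_eq: "topspace T = carrier X"
    and continuous_mult: "continuous_map (prod_topology T T) T (\<lambda>(x, y). x \<otimes> y)"
    and continuous_inv: "continuous_map T T (m_inv X)"

locale automorphism_action =
  group_action G "carrier X" \<alpha> + topological_group X T
  for G :: "('g, 'm) monoid_scheme" and X :: "('x, 'n) monoid_scheme"
    and T :: "'x topology" and \<alpha> :: "'g \<Rightarrow> 'x \<Rightarrow> 'x" +
  assumes action_hom: "g \<in> carrier G \<Longrightarrow> \<alpha> g \<in> hom X X"
    and action_continuous: "g \<in> carrier G \<Longrightarrow> continuous_map T T (\<alpha> g)"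

definition expansive ::
    "('g, 'm) monoid_scheme \<Rightarrow> 'x set \<Rightarrow> ('x \<Rightarrow> 'x \<Rightarrow> real) \<Rightarrow> ('g \<Rightarrow> 'x \<Rightarrow> 'x) \<Rightarrow> bool" where
  "expansive G M d \<alpha> \<longleftrightarrow>
     (\<exists>c>0. \<forall>x\<in>M. \<forall>y\<in>M. x \<noteq> y \<longrightarrow> (\<exists>g\<in>carrier G. d (\<alpha> g x) (\<alpha> g y) > c))"

text \<open>The filter below is convergence to infinity in the discrete group \<open>G\<close>:
  a property holds eventually iff it fails at only finitely many elements of \<open>G\<close>.\<close>

definition homoclinic_group ::
    "('g, 'm) monoid_scheme \<Rightarrow> ('x, 'n) monoid_scheme \<Rightarrow> 'x topology \<Rightarrow> ('g \<Rightarrow> 'x \<Rightarrow> 'x) \<Rightarrow> 'x set"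
  where
  "homoclinic_group G X T \<alpha> =
     {x \<in> carrier X.
        limitin T (\<lambda>s. \<alpha> s x) \<one>\<^bsub>X\<^esub> (inf cofinite (principal (carrier G)))}"


section \<open>Naive topological entropy\<close>

definition open_cover :: "'x topology \<Rightarrow> 'x set set \<Rightarrow> bool" where
  "open_cover T \<U> \<longleftrightarrow> (\<forall>U\<in>\<U>. openin T U) \<and> \<Union>\<U> = topspace T"

text \<open>Used only for covers that have a finite subcover; otherwise the value is unspecified.\<close>

definition min_subcover_card :: "'x set \<Rightarrow> 'x set set \<Rightarrow> nat" where
  "min_subcover_card M \<U> =
     (LEAST m. \<exists>\<V>. \<V> \<subseteq> \<U> \<and> finite \<V> \<and> card \<V> = m \<and> \<Union>\<V> = M)"

text \<open>A member of the join is the intersection of the preimages of \<open>f g \<in> \<U>\<close>, for \<open>g \<in> F\<close>.\<close>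

definition join_cover ::
    "'x set \<Rightarrow> ('g \<Rightarrow> 'x \<Rightarrow> 'x) \<Rightarrow> 'x set set \<Rightarrow> 'g set \<Rightarrow> 'x set set" where
  "join_cover M \<alpha> \<U> F = {{x \<in> M. \<forall>g\<in>F. \<alpha> g x \<in> f g} | f. f \<in> F \<rightarrow> \<U>}"

definition naive_entropy ::
    "('g, 'm) monoid_scheme \<Rightarrow> 'x topology \<Rightarrow> ('g \<Rightarrow> 'x \<Rightarrow> 'x) \<Rightarrow> ereal" where
  "naive_entropy G T \<alpha> =
     (SUP \<U>\<in>{\<U>. open_cover T \<U>}.
        INF F\<in>{F. finite F \<and> F \<noteq> {} \<and> F \<subseteq> carrier G}.
          ereal (ln (real (min_subcover_card (topspace T) (join_cover (topspace T) \<alpha> \<U> F)))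
                 / real (card F)))"


section \<open>Orbit independence\<close>

text \<open>A \<open>k\<close>-tuple of sets is a function on \<open>nat\<close> of which only the values on \<open>{1..k}\<close>
  matter; a \<open>k\<close>-tuple of points is an element of \<open>{1..k} \<rightarrow>\<^sub>E topspace T\<close>.\<close>

definition independence_set ::
    "'x set \<Rightarrow> ('g \<Rightarrow> 'x \<Rightarrow> 'x) \<Rightarrow> nat \<Rightarrow> (nat \<Rightarrow> 'x set) \<Rightarrow> 'g set \<Rightarrow> bool" where
  "independence_set M \<alpha> k A J \<longleftrightarrow>
     (\<forall>I \<phi>. I \<subseteq> J \<and> finite I \<and> I \<noteq> {} \<and> \<phi> \<in> I \<rightarrow> {1..k} \<longrightarrow>
        (\<Inter>s\<in>I. {x \<in> M. \<alpha> s x \<in> A (\<phi> s)}) \<noteq> {})"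

definition independence_density ::
    "('g, 'm) monoid_scheme \<Rightarrow> 'x set \<Rightarrow> ('g \<Rightarrow> 'x \<Rightarrow> 'x) \<Rightarrow> nat \<Rightarrow> (nat \<Rightarrow> 'x set) \<Rightarrow> real" where
  "independence_density G M \<alpha> k A =
     (GREATEST q. q \<ge> 0 \<and>
        (\<forall>F. finite F \<and> F \<subseteq> carrier G \<longrightarrow>
           (\<exists>J\<subseteq>F. independence_set M \<alpha> k A J \<and> real (card J) \<ge> q * real (card F))))"

definition IE_tuples ::
    "('g, 'm) monoid_scheme \<Rightarrow> 'x topology \<Rightarrow> ('g \<Rightarrow> 'x \<Rightarrow> 'x) \<Rightarrow> nat \<Rightarrow> (nat \<Rightarrow> 'x) set" where
  "IE_tuples G T \<alpha> k =
     {x \<in> {1..k} \<rightarrow>\<^sub>E topspace T.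
        \<forall>U. (\<forall>j\<in>{1..k}. openin T (U j) \<and> x j \<in> U j) \<longrightarrow>
            independence_density G (topspace T) \<alpha> k U > 0}"

definition naive_UPE_all_orders ::
    "('g, 'm) monoid_scheme \<Rightarrow> 'x topology \<Rightarrow> ('g \<Rightarrow> 'x \<Rightarrow> 'x) \<Rightarrow> bool" where
  "naive_UPE_all_orders G T \<alpha> \<longleftrightarrow>
     (\<forall>k\<ge>2. IE_tuples G T \<alpha> k = ({1..k} \<rightarrow>\<^sub>E topspace T))"


section \<open>Sofic approximations and sofic entropy\<close>

definition sofic_approximation ::
    "('g, 'm) monoid_scheme \<Rightarrow> (nat \<Rightarrow> nat) \<Rightarrow> (nat \<Rightarrow> 'g \<Rightarrow> nat \<Rightarrow> nat) \<Rightarrow> bool" where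
  "sofic_approximation G n \<sigma> \<longleftrightarrow>
     (\<forall>i. \<forall>s\<in>carrier G. \<sigma> i s permutes {1..n i}) \<and>
     filterlim n at_top sequentially \<and>
     (\<forall>s\<in>carrier G. \<forall>t\<in>carrier G.
        (\<lambda>i. real (card {v \<in> {1..n i}. \<sigma> i (s \<otimes>\<^bsub>G\<^esub> t) v = \<sigma> i s (\<sigma> i t v)}) / real (n i))
          \<longlonglongrightarrow> 1) \<and>
     (\<forall>s\<in>carrier G. \<forall>t\<in>carrier G. s \<noteq> t \<longrightarrow>
        (\<lambda>i. real (card {v \<in> {1..n i}. \<sigma> i s v \<noteq> \<sigma> i t v}) / real (n i)) \<longlonglongrightarrow> 1)"

definition sofic_maps ::
    "'x set \<Rightarrow> ('x \<Rightarrow> 'x \<Rightarrow> real) \<Rightarrow> ('g \<Rightarrow> 'x \<Rightarrow> 'x) \<Rightarrow> 'g set \<Rightarrow> real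
      \<Rightarrow> nat \<Rightarrow> ('g \<Rightarrow> nat \<Rightarrow> nat) \<Rightarrow> (nat \<Rightarrow> 'x) set" where
  "sofic_maps M d \<alpha> F \<delta> n \<sigma> =
     {\<phi> \<in> {1..n} \<rightarrow>\<^sub>E M.
        \<forall>s\<in>F. sqrt ((\<Sum>v=1..n. (d (\<phi> (\<sigma> s v)) (\<alpha> s (\<phi> v)))\<^sup>2) / real n) \<le> \<delta>}"

definition max_separated_card ::
    "('x \<Rightarrow> 'x \<Rightarrow> real) \<Rightarrow> nat \<Rightarrow> real \<Rightarrow> (nat \<Rightarrow> 'x) set \<Rightarrow> nat" where
  "max_separated_card d n \<epsilon> Y =
     (GREATEST m. \<exists>E\<subseteq>Y. finite E \<and> card E = m \<and>
        (\<forall>\<phi>\<in>E. \<forall>\<psi>\<in>E. \<phi> \<noteq> \<psi> \<longrightarrow> (MAX v\<in>{1..n}. d (\<phi> v) (\<psi> v)) \<ge> \<epsilon>))"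

definition log_card :: "nat \<Rightarrow> ereal" where
  "log_card m = (if m = 0 then -\<infinity> else ereal (ln (real m)))"

definition sofic_entropy ::
    "('g, 'm) monoid_scheme \<Rightarrow> 'x set \<Rightarrow> ('x \<Rightarrow> 'x \<Rightarrow> real) \<Rightarrow> ('g \<Rightarrow> 'x \<Rightarrow> 'x)
      \<Rightarrow> (nat \<Rightarrow> nat) \<Rightarrow> (nat \<Rightarrow> 'g \<Rightarrow> nat \<Rightarrow> nat) \<Rightarrow> ereal" where
  "sofic_entropy G M d \<alpha> n \<sigma> =
     (SUP \<epsilon>\<in>{0<..}. INF F\<in>{F. finite F \<and> F \<subseteq> carrier G}. INF \<delta>\<in>{0<..}.
        limsup (\<lambda>i. log_card (max_separated_card d (n i) \<epsilon> (sofic_maps M d \<alpha> F \<delta> (n i) (\<sigma> i)))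
                    / ereal (real (n i))))"


section \<open>Sofic independence\<close>

definition sofic_independence_set ::
    "'x set \<Rightarrow> ('x \<Rightarrow> 'x \<Rightarrow> real) \<Rightarrow> ('g \<Rightarrow> 'x \<Rightarrow> 'x) \<Rightarrow> 'g set \<Rightarrow> real \<Rightarrow> nat
      \<Rightarrow> ('g \<Rightarrow> nat \<Rightarrow> nat) \<Rightarrow> nat \<Rightarrow> (nat \<Rightarrow> 'x set) \<Rightarrow> nat set \<Rightarrow> bool" where
  "sofic_independence_set M d \<alpha> F \<delta> n \<sigma> k A J \<longleftrightarrow>
     J \<subseteq> {1..n} \<and>
     (\<forall>\<omega> \<in> J \<rightarrow> {1..k}. \<exists>\<phi> \<in> sofic_maps M d \<alpha> F \<delta> n \<sigma>. \<forall>a\<in>J. \<phi> a \<in> A (\<omega> a))"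

definition positive_upper_independence_density ::
    "('g, 'm) monoid_scheme \<Rightarrow> 'x set \<Rightarrow> ('x \<Rightarrow> 'x \<Rightarrow> real) \<Rightarrow> ('g \<Rightarrow> 'x \<Rightarrow> 'x)
      \<Rightarrow> (nat \<Rightarrow> nat) \<Rightarrow> (nat \<Rightarrow> 'g \<Rightarrow> nat \<Rightarrow> nat) \<Rightarrow> nat \<Rightarrow> (nat \<Rightarrow> 'x set) \<Rightarrow> bool" where
  "positive_upper_independence_density G M d \<alpha> n \<sigma> k A \<longleftrightarrow>
     (\<exists>q>0. \<forall>F \<delta>. finite F \<and> F \<subseteq> carrier G \<and> \<delta> > 0 \<longrightarrow>
        infinite {i. \<exists>J. sofic_independence_set M d \<alpha> F \<delta> (n i) (\<sigma> i) k A J \<and>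
                         real (card J) \<ge> q * real (n i)})"

definition sofic_IE_tuples ::
    "('g, 'm) monoid_scheme \<Rightarrow> 'x topology \<Rightarrow> ('x \<Rightarrow> 'x \<Rightarrow> real) \<Rightarrow> ('g \<Rightarrow> 'x \<Rightarrow> 'x)
      \<Rightarrow> (nat \<Rightarrow> nat) \<Rightarrow> (nat \<Rightarrow> 'g \<Rightarrow> nat \<Rightarrow> nat) \<Rightarrow> nat \<Rightarrow> (nat \<Rightarrow> 'x) set" where
  "sofic_IE_tuples G T d \<alpha> n \<sigma> k =
     {x \<in> {1..k} \<rightarrow>\<^sub>E topspace T.
        \<forall>U. (\<forall>j\<in>{1..k}. openin T (U j) \<and> x j \<in> U j) \<longrightarrow>
            positive_upper_independence_density G (topspace T) d \<alpha> n \<sigma> k U}"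

definition sofic_UPE_all_orders ::
    "('g, 'm) monoid_scheme \<Rightarrow> 'x topology \<Rightarrow> ('x \<Rightarrow> 'x \<Rightarrow> real) \<Rightarrow> ('g \<Rightarrow> 'x \<Rightarrow> 'x)
      \<Rightarrow> (nat \<Rightarrow> nat) \<Rightarrow> (nat \<Rightarrow> 'g \<Rightarrow> nat \<Rightarrow> nat) \<Rightarrow> bool" where
  "sofic_UPE_all_orders G T d \<alpha> n \<sigma> \<longleftrightarrow>
     (\<forall>k\<ge>2. sofic_IE_tuples G T d \<alpha> n \<sigma> k = ({1..k} \<rightarrow>\<^sub>E topspace T))"

end

theory Submission
  imports Defs
begin

text \<open>
  Let \<open>P\<close> be a finite set of homoclinic points and let \<open>J\<close> be a finite subset of \<open>G\<close> whose
  translates \<open>K t\<close>, \<open>t \<in> J\<close>, are disjoint. Consider a product \<open>y\<close> of the points \<open>t\<inverse> x\<^sub>t\<close>, with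
  \<open>x\<^sub>t \<in> P\<close>, in any order. If \<open>K\<close> is large enough in terms of \<open>P\<close> and the expansivity constant only,
  then \<open>g y\<close> is close to the identity for \<open>g \<notin> K J\<close> and close to \<open>g t\<inverse> x\<^sub>t\<close> for \<open>g \<in> K t\<close>, however
  large \<open>J\<close> is. In an induction on \<open>|J|\<close>, all but one of the factors of \<open>g y\<close> contribute something
  close to the identity, so \<open>g y\<close> lies within the expansivity constant of the identity unless \<open>g\<close> is
  near some \<open>t\<close>; expansivity, in its uniform form on a finite window, improves this to the
  closeness required by the induction.

  Hence every \<open>K\<close>-separated set is an independence set for neighbourhoods of homoclinic points,
  and every finite subset of \<open>G\<close> contains a \<open>K\<close>-separated subset of proportional size. Applied to
  the identity and a second homoclinic point, this gives positive entropy; when homoclinic points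
  are dense, it gives independence for all tuples.

  In the sofic case \<open>y\<close> is built at each vertex \<open>v\<close> from those \<open>t\<close> in a finite window \<open>D\<close> for which
  \<open>\<sigma> t v\<close> lies in a separated vertex set. Expansivity shows that \<open>y\<close> depends only weakly on factors
  far from the identity of \<open>G\<close>, so the resulting map is almost equivariant. The separation, and with
  it the density, depends on \<open>K\<close> but not on \<open>D\<close>.
\<close>

section \<open>Independence sets and entropy\<close>

text \<open>Choose an element, discard the at most \<open>m\<close> elements related to it, and
  recurse. \<open>R\<close> need not be symmetric, so both directions are counted; the clause
  \<open>b = a\<close> ensures that the chosen element is discarded too.\<close>

lemma greedy_independent_subset:
  assumes "finite S"
    and deg: "\<And>a. a \<in> S \<Longrightarrow> card {b \<in> S. b = a \<or> R a b \<or> R b a} \<le> m"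
  obtains J where "J \<subseteq> S" "card S \<le> m * card J"
    "\<And>a b. a \<in> J \<Longrightarrow> b \<in> J \<Longrightarrow> R a b \<Longrightarrow> a = b"
proof -
  have "\<exists>J\<subseteq>S. card S \<le> m * card J \<and> (\<forall>a\<in>J. \<forall>b\<in>J. R a b \<longrightarrow> a = b)"
    using assms
  proof (induction S rule: finite_psubset_induct)
    case (psubset S)
    show ?case
    proof (cases "S = {}")
      case False
      then obtain a where a: "a \<in> S"
        by blast
      define N where "N = {b \<in> S. b = a \<or> R a b \<or> R b a}"
      have "S - N \<subset> S"
        using a by (auto simp: N_def)
      moreover have "card {b \<in> S - N. b = c \<or> R c b \<or> R b c} \<le> m" if "c \<in> S - N" for c
      proof -
        have "card {b \<in> S - N. b = c \<or> R c b \<or> R b c} \<le> card {b \<in> S. b = c \<or> R c b \<or> R b c}"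
          using psubset.hyps by (intro card_mono) auto
        then show ?thesis
          using psubset.prems[of c] that by simp
      qed
      ultimately obtain J where J: "J \<subseteq> S - N" "card (S - N) \<le> m * card J"
        "\<forall>a\<in>J. \<forall>b\<in>J. R a b \<longrightarrow> a = b"
        using psubset.IH[of "S - N"] by blast
      have "finite J"
        using J(1) psubset.hyps by (metis finite_Diff finite_subset)
      have "a \<notin> J"
        using J(1) a by (auto simp: N_def)
      have "card S \<le> card N + card (S - N)"
        using card_Un_le[of N "S - N"] by (simp add: N_def Un_absorb1)
      also have "\<dots> \<le> m + m * card J"
        using psubset.prems[OF a] J(2) by (simp add: N_def)
      also have "\<dots> = m * card (insert a J)"
        using \<open>finite J\<close> \<open>a \<notin> J\<close> by simp
      finally have "card S \<le> m * card (insert a J)" .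
      moreover have "\<forall>b\<in>insert a J. \<forall>c\<in>insert a J. R b c \<longrightarrow> b = c"
        using J(1,3) by (auto simp: N_def)
      moreover have "insert a J \<subseteq> S"
        using J(1) a by blast
      ultimately show ?thesis
        by blast
    qed auto
  qed
  then show ?thesis
    using that by blast
qed

text \<open>\<open>GREATEST\<close> over the reals is informative only if the maximum is attained. A
  singleton bounds the admissible densities by 1, and each \<open>F\<close> imposes the closed
  condition that \<open>p * card F\<close> is at most the largest size of an independence set in
  \<open>F\<close>; so the supremum is itself admissible.\<close>

lemma independence_density_pos:
  assumes "g \<in> carrier G" "q > 0"
    and "\<And>F. finite F \<Longrightarrow> F \<subseteq> carrier G \<Longrightarrow>
      \<exists>J\<subseteq>F. independence_set M \<alpha> k A J \<and> q * real (card F) \<le> real (card J)"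
  shows "independence_density G M \<alpha> k A > 0"
proof -
  define Q where "Q = {q. q \<ge> 0 \<and> (\<forall>F. finite F \<and> F \<subseteq> carrier G \<longrightarrow>
    (\<exists>J\<subseteq>F. independence_set M \<alpha> k A J \<and> real (card J) \<ge> q * real (card F)))}"
  have q: "q \<in> Q"
    using assms(2,3) by (auto simp: Q_def)
  have le: "p * real (card F) \<le> real (Max (card ` {J. J \<subseteq> F \<and> independence_set M \<alpha> k A J}))"
    if p: "p \<in> Q" and F: "finite F" "F \<subseteq> carrier G" for p F
  proof -
    obtain J where J: "J \<subseteq> F" "independence_set M \<alpha> k A J" "p * real (card F) \<le> real (card J)"
      using p F by (auto simp: Q_def)
    have "card J \<le> Max (card ` {J. J \<subseteq> F \<and> independence_set M \<alpha> k A J})"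
      using J F by (intro Max_ge) auto
    then show ?thesis
      using J(3) by linarith
  qed
  have bdd: "bdd_above Q"
  proof (rule bdd_aboveI)
    fix p assume "p \<in> Q"
    then have "\<exists>J\<subseteq>{g}. independence_set M \<alpha> k A J \<and> real (card J) \<ge> p * real (card {g})"
      using assms(1) unfolding Q_def by blast
    then obtain J where J: "J \<subseteq> {g}" "p * real (card {g}) \<le> real (card J)"
      by blast
    have "card J \<le> card {g}"
      using J(1) by (intro card_mono) auto
    with J(2) show "p \<le> 1"
      by simp
  qed
  define S where "S = Sup Q"
  have ge: "p \<le> S" if "p \<in> Q" for p
    unfolding S_def using that bdd by (intro cSup_upper)
  have "S \<in> Q"
    unfolding Q_def
  proof (intro CollectI conjI allI impI)
    show "0 \<le> S"
      using ge[OF q] assms(2) by linarith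
    fix F assume F: "finite F \<and> F \<subseteq> carrier G"
    define C where "C = {J. J \<subseteq> F \<and> independence_set M \<alpha> k A J}"
    have C: "finite C" "C \<noteq> {}"
      using F assms(3)[of F] by (auto simp: C_def)
    then have "Max (card ` C) \<in> card ` C"
      by (intro Max_in) auto
    then obtain J where J: "J \<in> C" "card J = Max (card ` C)"
      by auto
    have "S * real (card F) \<le> real (card J)"
    proof (cases "F = {}")
      case False
      then have pos: "real (card F) > 0"
        using F by (simp add: card_gt_0_iff)
      have "S \<le> real (card J) / real (card F)"
        unfolding S_def using q le[of _ F] F pos J(2) by (intro cSup_least) (auto simp: C_def field_simps)
      then show ?thesis
        using pos by (simp add: field_simps)
    qed simp
    then show "\<exists>J\<subseteq>F. independence_set M \<alpha> k A J \<and> real (card J) \<ge> S * real (card F)"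
      using J(1) by (auto simp: C_def)
  qed
  then have "independence_density G M \<alpha> k A = S"
    unfolding independence_density_def
    by (intro Greatest_equality ge) (auto simp: Q_def)
  then show ?thesis
    using ge[OF q] assms(2) by linarith
qed

text \<open>Independence speaks of nonempty \<open>I\<close> only; for empty \<open>J\<close> the
  point comes from \<open>M \<noteq> {}\<close>.\<close>

lemma independent_points:
  assumes "independence_set M \<alpha> k A J" "finite J" "M \<noteq> {}" "\<omega> \<in> J \<rightarrow> {1..k}"
  obtains y where "y \<in> M" "\<And>s. s \<in> J \<Longrightarrow> \<alpha> s y \<in> A (\<omega> s)"
proof (cases "J = {}")
  case True
  then show ?thesis
    using assms(3) that by blast
next
  case False
  then have "(\<Inter>s\<in>J. {x \<in> M. \<alpha> s x \<in> A (\<omega> s)}) \<noteq> {}"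
    using assms unfolding independence_set_def by blast
  then show ?thesis
    using that False by blast
qed

section \<open>Counting patterns by subcovers\<close>

text \<open>At each \<open>s \<in> J\<close> a member of the join misses \<open>A 1\<close> or
  \<open>A 2\<close>, so it contains points realizing at most one pattern on \<open>J\<close>. Hence
  the \<open>2 ^ card J\<close> patterns need different members.\<close>

lemma min_subcover_card_join_ge:
  assumes "finite F" "J \<subseteq> F" "independence_set M \<alpha> 2 A J" "M \<noteq> {}"
    and disj: "A 1 \<inter> A 2 = {}"
    and act: "\<And>g x. g \<in> F \<Longrightarrow> x \<in> M \<Longrightarrow> \<alpha> g x \<in> M"
  shows "2 ^ card J \<le> min_subcover_card M (join_cover M \<alpha> {M - A 1, M - A 2} F)"
proof -
  define \<U> where "\<U> = {M - A 1, M - A 2}"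
  define \<W> where "\<W> = join_cover M \<alpha> \<U> F"
  define member where "member f = {x \<in> M. \<forall>g\<in>F. \<alpha> g x \<in> f g}" for f
  have \<W>: "\<W> = member ` (F \<rightarrow> \<U>)"
    by (auto simp: \<W>_def join_cover_def member_def)
  \<comment> \<open>Functions in \<open>F \<rightarrow> \<U>\<close> are arbitrary off
    \<open>F\<close>; restricting them to \<open>F\<close> shows that the join has finitely many
    members.\<close>
  have "\<W> = member ` (F \<rightarrow>\<^sub>E \<U>)"
  proof
    show "\<W> \<subseteq> member ` (F \<rightarrow>\<^sub>E \<U>)"
    proof
      fix V assume "V \<in> \<W>"
      then obtain f where f: "f \<in> F \<rightarrow> \<U>" "V = member f"
        using \<W> by auto
      then have "V = member (restrict f F)" "restrict f F \<in> F \<rightarrow>\<^sub>E \<U>"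
        by (auto simp: member_def)
      then show "V \<in> member ` (F \<rightarrow>\<^sub>E \<U>)"
        by blast
    qed
  qed (auto simp: \<W> PiE_def)
  then have "finite \<W>"
    using assms(1) by (simp add: finite_PiE \<U>_def)
  moreover have "\<Union>\<W> = M"
  proof
    show "M \<subseteq> \<Union>\<W>"
    proof
      fix x assume x: "x \<in> M"
      define f where "f = (\<lambda>g. if \<alpha> g x \<in> A 1 then M - A 2 else M - A 1)"
      have "f \<in> F \<rightarrow> \<U>"
        by (auto simp: f_def \<U>_def)
      moreover have "x \<in> member f"
        using x act disj by (auto simp: member_def f_def)
      ultimately show "x \<in> \<Union>\<W>"
        using \<W> by blast
    qed
  qed (auto simp: \<W> member_def)
  \<comment> \<open>The join is a finite subcover of itself, so the \<open>LEAST\<close> in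
    \<open>min_subcover_card\<close> is attained.\<close>
  ultimately have "\<exists>m. \<exists>\<V>. \<V> \<subseteq> \<W> \<and> finite \<V> \<and> card \<V> = m \<and> \<Union>\<V> = M"
    by blast
  from LeastI_ex[OF this] obtain \<V> where \<V>: "\<V> \<subseteq> \<W>" "finite \<V>" "\<Union>\<V> = M"
    "card \<V> = min_subcover_card M \<W>"
    unfolding min_subcover_card_def by blast
  have finJ: "finite J"
    using assms(1,2) finite_subset by blast
  have "\<exists>V\<in>\<V>. \<exists>y\<in>V. \<forall>s\<in>J. \<alpha> s y \<in> A (\<omega> s)" if \<omega>: "\<omega> \<in> J \<rightarrow>\<^sub>E {1..2}" for \<omega>
  proof -
    have "\<omega> \<in> J \<rightarrow> {1..2}"
      using \<omega> by auto
    from independent_points[OF assms(3) finJ assms(4) this]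
    obtain y where "y \<in> M" "\<And>s. s \<in> J \<Longrightarrow> \<alpha> s y \<in> A (\<omega> s)"
      by blast
    then show ?thesis
      using \<V>(3) by blast
  qed
  then obtain V where V: "\<And>\<omega>. \<omega> \<in> J \<rightarrow>\<^sub>E {1..2} \<Longrightarrow> V \<omega> \<in> \<V>"
    "\<And>\<omega>. \<omega> \<in> J \<rightarrow>\<^sub>E {1..2} \<Longrightarrow> \<exists>y\<in>V \<omega>. \<forall>s\<in>J. \<alpha> s y \<in> A (\<omega> s)"
    by metis
  have "inj_on V (J \<rightarrow>\<^sub>E {1..2})"
  proof (rule inj_onI)
    fix \<omega> \<omega>' assume \<omega>: "\<omega> \<in> J \<rightarrow>\<^sub>E {1..2::nat}" "\<omega>' \<in> J \<rightarrow>\<^sub>E {1..2}" "V \<omega> = V \<omega>'"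
    obtain f where f: "f \<in> F \<rightarrow> \<U>" "V \<omega> = member f"
      using V(1)[OF \<omega>(1)] \<V>(1) \<W> by blast
    obtain y y' where y: "y \<in> member f" "\<forall>s\<in>J. \<alpha> s y \<in> A (\<omega> s)"
      "y' \<in> member f" "\<forall>s\<in>J. \<alpha> s y' \<in> A (\<omega>' s)"
      using V(2)[OF \<omega>(1)] V(2)[OF \<omega>(2)] f(2) \<omega>(3) by metis
    show "\<omega> = \<omega>'"
    proof (rule PiE_ext[OF \<omega>(1,2)])
      fix s assume s: "s \<in> J"
      then have "\<alpha> s y \<in> f s \<inter> A (\<omega> s)" "\<alpha> s y' \<in> f s \<inter> A (\<omega>' s)" "f s \<in> \<U>"
        using y f(1) assms(2) by (auto simp: member_def)
      moreover have "\<omega> s \<in> {1..2}" "\<omega>' s \<in> {1..2}"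
        using \<omega>(1,2) s by auto
      then have "\<omega> s = 1 \<or> \<omega> s = 2" "\<omega>' s = 1 \<or> \<omega>' s = 2"
        by auto
      ultimately show "\<omega> s = \<omega>' s"
        by (auto simp: \<U>_def)
    qed
  qed
  then have "card (J \<rightarrow>\<^sub>E {1..2::nat}) \<le> card \<V>"
    using V(1) \<V>(2) by (intro card_inj_on_le[of V]) auto
  then show ?thesis
    using \<V>(4) finJ by (simp add: card_funcsetE \<W>_def \<U>_def)
qed

text \<open>Both entropy bounds count \<open>2 ^ m\<close> patterns on an independence set of size
  \<open>m\<close> among \<open>a\<close> elements.\<close>

lemma ln_rate_of_exponential:
  assumes "2 ^ m \<le> N" "q * real a \<le> real m" "a > 0"
  shows "q * ln 2 \<le> ln (real N) / real a"
proof -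
  have "2 ^ m \<le> real N"
    using assms(1) of_nat_le_iff[where 'a = real] by fastforce
  then have "ln (2 ^ m) \<le> ln (real N)"
    by (intro ln_mono) auto
  moreover have "q * real a * ln 2 \<le> real m * ln 2"
    using assms(2) by (intro mult_right_mono) auto
  moreover have "ln (2 ^ m) = real m * ln 2"
    by (simp add: ln_realpow)
  ultimately have "q * real a * ln 2 \<le> ln (real N)"
    by linarith
  then have "q * ln 2 * real a \<le> ln (real N)"
    by (simp only: mult_ac)
  then show ?thesis
    using \<open>a > 0\<close> by (simp add: pos_le_divide_eq)
qed

section \<open>Sofic approximations\<close>

text \<open>Union bound: each of the finitely many failure proportions tends to 0, hence so does
  their sum.\<close>

lemma eventually_few_exceptions:
  fixes n :: "nat \<Rightarrow> nat"
  assumes "finite I" "filterlim n at_top sequentially" "\<kappa> > 0"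
    and Q: "\<And>j. j \<in> I \<Longrightarrow> (\<lambda>i. real (card {v \<in> {1..n i}. Q j i v}) / real (n i)) \<longlonglongrightarrow> 1"
  shows "\<forall>\<^sub>F i in sequentially. real (card {v \<in> {1..n i}. \<exists>j\<in>I. \<not> Q j i v}) \<le> \<kappa> * real (n i)"
proof -
  have "(\<lambda>i. \<Sum>j\<in>I. 1 - real (card {v \<in> {1..n i}. Q j i v}) / real (n i)) \<longlonglongrightarrow> (\<Sum>j\<in>I. 1 - 1)"
    by (intro tendsto_intros Q)
  then have "\<forall>\<^sub>F i in sequentially. (\<Sum>j\<in>I. 1 - real (card {v \<in> {1..n i}. Q j i v}) / real (n i)) < \<kappa>"
    using \<open>\<kappa> > 0\<close> by (intro order_tendstoD(2)) auto
  moreover have "\<forall>\<^sub>F i in sequentially. n i > 0"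
    using assms(2) unfolding filterlim_at_top by (auto elim: allE[of _ 1] simp: Suc_le_eq)
  ultimately show ?thesis
  proof eventually_elim
    case (elim i)
    have "{v \<in> {1..n i}. \<exists>j\<in>I. \<not> Q j i v} = (\<Union>j\<in>I. {v \<in> {1..n i}. \<not> Q j i v})"
      by auto
    then have "real (card {v \<in> {1..n i}. \<exists>j\<in>I. \<not> Q j i v}) \<le> (\<Sum>j\<in>I. real (card {v \<in> {1..n i}. \<not> Q j i v}))"
      using card_UN_le[OF \<open>finite I\<close>, of "\<lambda>j. {v \<in> {1..n i}. \<not> Q j i v}"]
      by (simp flip: of_nat_sum)
    also have "\<dots> = (\<Sum>j\<in>I. (1 - real (card {v \<in> {1..n i}. Q j i v}) / real (n i)) * real (n i))"
    proof (rule sum.cong)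
      fix j
      have "card ({1..n i} - {v \<in> {1..n i}. Q j i v}) = n i - card {v \<in> {1..n i}. Q j i v}"
        by (subst card_Diff_subset) auto
      moreover have "{1..n i} - {v \<in> {1..n i}. Q j i v} = {v \<in> {1..n i}. \<not> Q j i v}"
        by auto
      moreover have "card {v \<in> {1..n i}. Q j i v} \<le> card {1..n i}"
        by (intro card_mono) auto
      ultimately show "real (card {v \<in> {1..n i}. \<not> Q j i v}) =
          (1 - real (card {v \<in> {1..n i}. Q j i v}) / real (n i)) * real (n i)"
        using elim(2) by (simp add: field_simps of_nat_diff)
    qed simp
    also have "\<dots> = (\<Sum>j\<in>I. 1 - real (card {v \<in> {1..n i}. Q j i v}) / real (n i)) * real (n i)"
      by (simp only: sum_distrib_right)
    also have "\<dots> \<le> \<kappa> * real (n i)"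
      using elim(1) by (intro mult_right_mono) auto
    finally show ?case .
  qed
qed

text \<open>At such a vertex, \<open>\<sigma>\<close> looks like left translation of
  \<open>G\<close> on itself, as far as \<open>E\<close> can see.\<close>

definition free_vertex ::
    "('g, 'm) monoid_scheme \<Rightarrow> 'g set \<Rightarrow> ('g \<Rightarrow> nat \<Rightarrow> nat) \<Rightarrow> nat \<Rightarrow> bool" where
  "free_vertex G E \<sigma> v \<longleftrightarrow>
     (\<forall>s\<in>E. \<forall>t\<in>E. \<sigma> (s \<otimes>\<^bsub>G\<^esub> t) v = \<sigma> s (\<sigma> t v) \<and> (s \<noteq> t \<longrightarrow> \<sigma> s v \<noteq> \<sigma> t v))"

lemma sofic_approximation_eventually_free:
  assumes "sofic_approximation G n \<sigma>" "finite E" "E \<subseteq> carrier G" "\<kappa> > 0"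
  shows "\<forall>\<^sub>F i in sequentially.
    real (card {v \<in> {1..n i}. \<not> free_vertex G E (\<sigma> i) v}) \<le> \<kappa> * real (n i)"
proof -
  \<comment> \<open>The Boolean selects multiplicativity or freeness, so that one finite index set
    serves both.\<close>
  define Q where "Q = (\<lambda>(s, t, b) i v. if b then \<sigma> i (s \<otimes>\<^bsub>G\<^esub> t) v = \<sigma> i s (\<sigma> i t v)
    else s \<noteq> t \<longrightarrow> \<sigma> i s v \<noteq> \<sigma> i t v)"
  have n: "filterlim n at_top sequentially"
    using assms(1) by (simp add: sofic_approximation_def)
  have "(\<lambda>i. real (card {v \<in> {1..n i}. Q j i v}) / real (n i)) \<longlonglongrightarrow> 1"
    if "j \<in> E \<times> E \<times> UNIV" for j
  proof -
    obtain s t b where j: "j = (s, t, b)"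
      by (cases j)
    then have G: "s \<in> carrier G" "t \<in> carrier G"
      using that assms(3) by auto
    consider "b" | "\<not> b" "s \<noteq> t" | "\<not> b" "s = t"
      by blast
    then show ?thesis
    proof cases
      \<comment> \<open>Nothing can fail here, but the proportion equals 1 only once
        \<open>n i\<close> is positive, since \<open>0 / 0 = 0\<close>.\<close>
      case 3
      have "\<forall>\<^sub>F i in sequentially. n i > 0"
        using n unfolding filterlim_at_top by (auto elim: allE[of _ 1] simp: Suc_le_eq)
      moreover have "{v \<in> {1..n i}. Q j i v} = {1..n i}" for i
        by (auto simp: Q_def j 3)
      ultimately have "\<forall>\<^sub>F i in sequentially. real (card {v \<in> {1..n i}. Q j i v}) / real (n i) = 1"
        by (auto elim: eventually_mono)
      then show ?thesis
        by (rule tendsto_eventually)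
    qed (use assms(1) G j in \<open>auto simp: sofic_approximation_def Q_def\<close>)
  qed
  then have "\<forall>\<^sub>F i in sequentially.
      real (card {v \<in> {1..n i}. \<exists>j\<in>E \<times> E \<times> UNIV. \<not> Q j i v}) \<le> \<kappa> * real (n i)"
    using assms(2,4) n by (intro eventually_few_exceptions) auto
  moreover have "(\<exists>j\<in>E \<times> E \<times> UNIV. \<not> Q j i v) \<longleftrightarrow> \<not> free_vertex G E (\<sigma> i) v" for i v
    by (auto simp: free_vertex_def Q_def split: if_splits)
  ultimately show ?thesis
    by simp
qed

text \<open>Vertices off \<open>B\<close> contribute at most \<open>\<delta>\<^sup>2 / 4\<close> to
  the mean square, those in \<open>B\<close> at most \<open>\<delta>\<^sup>2 / 2\<close>.\<close>

lemma sofic_mapsI: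
  assumes \<phi>: "\<phi> \<in> {1..n} \<rightarrow>\<^sub>E M" and "n > 0" "\<delta> > 0"
    and free: "\<And>s v. s \<in> F \<Longrightarrow> v \<in> {1..n} - B \<Longrightarrow> d (\<phi> (\<sigma> s v)) (\<alpha> s (\<phi> v)) \<le> \<delta> / 2"
    and diam: "\<And>s v. s \<in> F \<Longrightarrow> v \<in> {1..n} \<Longrightarrow> d (\<phi> (\<sigma> s v)) (\<alpha> s (\<phi> v)) \<le> L"
    and nonneg: "\<And>x y. 0 \<le> d x y"
    and B: "B \<subseteq> {1..n}" "real (card B) * L\<^sup>2 \<le> real n * \<delta>\<^sup>2 / 2"
  shows "\<phi> \<in> sofic_maps M d \<alpha> F \<delta> n \<sigma>"
proof -
  have "sqrt ((\<Sum>v=1..n. (d (\<phi> (\<sigma> s v)) (\<alpha> s (\<phi> v)))\<^sup>2) / real n) \<le> \<delta>" if s: "s \<in> F" for s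
  proof -
    define e where "e v = (d (\<phi> (\<sigma> s v)) (\<alpha> s (\<phi> v)))\<^sup>2" for v
    have "(\<Sum>v=1..n. e v) = (\<Sum>v\<in>{1..n} - B. e v) + (\<Sum>v\<in>B. e v)"
      using B(1) by (simp add: sum.subset_diff)
    also have "(\<Sum>v\<in>{1..n} - B. e v) \<le> real (card ({1..n} - B)) * (\<delta> / 2)\<^sup>2"
      using free[OF s] nonneg unfolding e_def by (intro sum_bounded_above power_mono) auto
    also have "\<dots> \<le> real n * (\<delta> / 2)\<^sup>2"
      using card_mono[of "{1..n}" "{1..n} - B"] by (intro mult_right_mono) auto
    also have "(\<Sum>v\<in>B. e v) \<le> real (card B) * L\<^sup>2"
      using diam[OF s] B(1) nonneg unfolding e_def by (intro sum_bounded_above power_mono) auto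
    also note B(2)
    also have "real n * (\<delta> / 2)\<^sup>2 + real n * \<delta>\<^sup>2 / 2 \<le> real n * \<delta>\<^sup>2"
      by (simp add: power_divide)
    finally have "(\<Sum>v=1..n. e v) / real n \<le> \<delta>\<^sup>2"
      using \<open>n > 0\<close> by (simp add: field_simps)
    then show ?thesis
      unfolding e_def using \<open>\<delta> > 0\<close> by (intro real_le_lsqrt) auto
  qed
  then show ?thesis
    using \<phi> by (simp add: sofic_maps_def)
qed

section \<open>Expansive actions on compact groups\<close>

text \<open>The expansivity constant is a parameter because the tolerances of the shadowing argument
  are measured against it.\<close>

locale expansive_compact_action =
  automorphism_action G X T \<alpha> + Metric_space "carrier X" d
  for G :: "('g, 'm) monoid_scheme" and X :: "('x, 'n) monoid_scheme" (structure)
    and T :: "'x topology" and \<alpha> :: "'g \<Rightarrow> 'x \<Rightarrow> 'x" and d :: "'x \<Rightarrow> 'x \<Rightarrow> real" +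
  fixes c :: real
  assumes compact: "compact_space T"
    and compatible: "mtopology = T"
    and c_pos: "c > 0"
    and c_expansive: "\<And>x y. x \<in> carrier X \<Longrightarrow> y \<in> carrier X \<Longrightarrow> x \<noteq> y \<Longrightarrow>
      \<exists>g\<in>carrier G. d (\<alpha> g x) (\<alpha> g y) > c"
begin

sublocale G: group G
  using group_hom by (rule group_hom.axioms)

abbreviation homoclinic :: "'x set" where
  "homoclinic \<equiv> homoclinic_group G X T \<alpha>"

lemma act_closed [simp]: "g \<in> carrier G \<Longrightarrow> x \<in> carrier X \<Longrightarrow> \<alpha> g x \<in> carrier X"
  by (rule element_image[OF _ _ refl])

lemma act_mult:
  "g \<in> carrier G \<Longrightarrow> x \<in> carrier X \<Longrightarrow> y \<in> carrier X \<Longrightarrow> \<alpha> g (x \<otimes> y) = \<alpha> g x \<otimes> \<alpha> g y"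
  by (rule hom_mult[OF action_hom])

lemma act_one [simp]: "g \<in> carrier G \<Longrightarrow> \<alpha> g \<one> = \<one>"
  by (rule hom_one[OF action_hom is_group is_group])

lemma act_act:
  "g \<in> carrier G \<Longrightarrow> h \<in> carrier G \<Longrightarrow> x \<in> carrier X \<Longrightarrow> \<alpha> g (\<alpha> h x) = \<alpha> (g \<otimes>\<^bsub>G\<^esub> h) x"
  by (rule composition_rule[symmetric])

lemma act_id [simp]: "x \<in> carrier X \<Longrightarrow> \<alpha> \<one>\<^bsub>G\<^esub> x = x"
  by (simp flip: id_eq_one)

lemma continuous_map_d:
  "continuous_map Y T f \<Longrightarrow> continuous_map Y T f' \<Longrightarrow>
     continuous_map Y euclideanreal (\<lambda>x. d (f x) (f' x))"
  using continuous_map_mdist[of Y Self f f'] by (simp add: mtopology_of_def compatible)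

section \<open>Uniform estimates from compactness\<close>

text \<open>The pairs at distance less than \<open>\<epsilon>\<close> and, for each
  \<open>g\<close>, the pairs that \<open>g\<close> drives more than \<open>c\<close> apart form an
  open cover of the compact square of \<open>X\<close>. The elements \<open>g\<close> occurring in a
  finite subcover make up \<open>W\<close>.\<close>

lemma expansive_window:
  assumes "\<epsilon> > 0"
  obtains W where "finite W" "W \<subseteq> carrier G"
    "\<And>x y. x \<in> carrier X \<Longrightarrow> y \<in> carrier X \<Longrightarrow> (\<And>w. w \<in> W \<Longrightarrow> d (\<alpha> w x) (\<alpha> w y) \<le> c) \<Longrightarrow> d x y < \<epsilon>"
proof -
  let ?P = "prod_topology T T"
  have cont: "continuous_map ?P T fst" "continuous_map ?P T snd"
    by (auto intro: continuous_map_fst continuous_map_snd)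
  define O0 where "O0 = {p \<in> topspace ?P. d (fst p) (snd p) \<in> {..<\<epsilon>}}"
  define Og where "Og g = {p \<in> topspace ?P. d (\<alpha> g (fst p)) (\<alpha> g (snd p)) \<in> {c<..}}" for g
  have open_O0: "openin ?P O0"
    unfolding O0_def by (intro openin_continuous_map_preimage[OF continuous_map_d[OF cont]]) auto
  have open_Og: "openin ?P (Og g)" if "g \<in> carrier G" for g
    unfolding Og_def
    by (intro openin_continuous_map_preimage[OF continuous_map_d]
        continuous_map_compose[OF cont(1) action_continuous[OF that], unfolded o_def]
        continuous_map_compose[OF cont(2) action_continuous[OF that], unfolded o_def]) auto
  have covers: "topspace ?P \<subseteq> \<Union>(insert O0 (Og ` carrier G))"
  proof
    fix p assume p: "p \<in> topspace ?P"
    then obtain x y where xy: "p = (x, y)" "x \<in> carrier X" "y \<in> carrier X"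
      using topspace_eq by auto
    show "p \<in> \<Union>(insert O0 (Og ` carrier G))"
    proof (cases "x = y")
      case True
      then show ?thesis
        using p xy assms by (auto simp: O0_def)
    next
      case False
      then show ?thesis
        using c_expansive[of x y] p xy by (auto simp: Og_def)
    qed
  qed
  have comp: "compactin ?P (topspace ?P)"
    using compact compact_space_prod_topology[of T T] unfolding compact_space_def by simp
  have "openin ?P U" if "U \<in> insert O0 (Og ` carrier G)" for U
    using that open_O0 open_Og by blast
  then obtain \<F> where \<F>: "finite \<F>" "\<F> \<subseteq> insert O0 (Og ` carrier G)" "topspace ?P \<subseteq> \<Union>\<F>"
    by (rule compactinD[OF comp _ covers, THEN exE]) blast+
  then have "finite (\<F> - {O0})" "\<F> - {O0} \<subseteq> Og ` carrier G"
    by auto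
  then obtain W where W: "W \<subseteq> carrier G" "finite W" "\<F> - {O0} = Og ` W"
    by (metis finite_subset_image)
  show ?thesis
  proof
    fix x y
    assume xy: "x \<in> carrier X" "y \<in> carrier X"
      and le: "\<And>w. w \<in> W \<Longrightarrow> d (\<alpha> w x) (\<alpha> w y) \<le> c"
    have "(x, y) \<in> \<Union>\<F>"
      using \<F>(3) xy topspace_eq by auto
    then have "(x, y) \<in> O0 \<or> (x, y) \<in> \<Union>(Og ` W)"
      using W(3) by blast
    then show "d x y < \<epsilon>"
      using le by (fastforce simp: O0_def Og_def)
  qed (use W in auto)
qed

text \<open>The tube lemma makes \<open>\<eta>\<close> independent of the middle factor
  \<open>b\<close>. It is applied once for left and once for right multiplication, as
  \<open>X\<close> need not be abelian.\<close>

lemma uniform_mult: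
  assumes "\<epsilon> > 0"
  obtains \<eta> where "\<eta> > 0"
    "\<And>a b b'. a \<in> carrier X \<Longrightarrow> b \<in> carrier X \<Longrightarrow> b' \<in> carrier X \<Longrightarrow> d a \<one> < \<eta> \<Longrightarrow> d b' \<one> < \<eta> \<Longrightarrow>
       d (a \<otimes> b \<otimes> b') b < \<epsilon>"
proof -
  let ?P = "prod_topology T T"
  have cont: "continuous_map ?P T fst" "continuous_map ?P T snd"
    by (auto intro: continuous_map_fst continuous_map_snd)
  have mult: "continuous_map ?P T (\<lambda>p. fst p \<otimes> snd p)"
    using continuous_mult by (simp add: case_prod_unfold)
  have C: "compactin T (carrier X)"
    using compact topspace_eq by (simp add: compact_space_def)
  have one: "\<one> \<in> topspace T"
    using topspace_eq by simp
  define L where "L = {p \<in> topspace ?P. d (fst p \<otimes> snd p) (snd p) \<in> {..<\<epsilon>/2}}"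
  define R where "R = {p \<in> topspace ?P. d (fst p \<otimes> snd p) (fst p) \<in> {..<\<epsilon>/2}}"
  have "openin ?P L" "openin ?P R"
    unfolding L_def R_def
    by (intro openin_continuous_map_preimage[OF continuous_map_d[OF mult]] cont; simp)+
  moreover have "{\<one>} \<times> carrier X \<subseteq> L" "carrier X \<times> {\<one>} \<subseteq> R"
    using assms topspace_eq by (auto simp: L_def R_def)
  ultimately obtain U U' V V' where UV: "openin T U" "\<one> \<in> U" "carrier X \<subseteq> V" "U \<times> V \<subseteq> L"
    "openin T V'" "\<one> \<in> V'" "carrier X \<subseteq> U'" "U' \<times> V' \<subseteq> R"
    using tube_lemma_right[OF _ C one] tube_lemma_left[OF _ C one] by metis
  then have "openin T (U \<inter> V')" "\<one> \<in> U \<inter> V'"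
    by auto
  then obtain \<eta> where \<eta>: "\<eta> > 0" "mball \<one> \<eta> \<subseteq> U \<inter> V'"
    unfolding compatible[symmetric] openin_mtopology by metis
  show ?thesis
  proof
    fix a b b'
    assume X: "a \<in> carrier X" "b \<in> carrier X" "b' \<in> carrier X" and "d a \<one> < \<eta>" "d b' \<one> < \<eta>"
    then have "a \<in> mball \<one> \<eta>" "b' \<in> mball \<one> \<eta>"
      by (auto simp: commute)
    then have "a \<in> U" "b' \<in> V'"
      using \<eta>(2) by auto
    then have "d (a \<otimes> (b \<otimes> b')) (b \<otimes> b') < \<epsilon>/2" "d (b \<otimes> b') b < \<epsilon>/2"
      using UV X by (auto simp: L_def R_def set_eq_iff subset_iff)
    moreover have "d (a \<otimes> b \<otimes> b') b \<le> d (a \<otimes> (b \<otimes> b')) (b \<otimes> b') + d (b \<otimes> b') b"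
      using X by (simp add: m_assoc triangle)
    ultimately show "d (a \<otimes> b \<otimes> b') b < \<epsilon>"
      by simp
  qed (rule \<eta>(1))
qed

section \<open>Homoclinic points\<close>

lemma homoclinic_subset: "homoclinic \<subseteq> carrier X"
  by (auto simp: homoclinic_group_def)

lemma one_homoclinic: "\<one> \<in> homoclinic"
  unfolding homoclinic_group_def compatible[symmetric] limitin_metric
  by (simp add: eventually_inf_principal)

lemma homoclinic_finite:
  assumes "x \<in> homoclinic" "\<eta> > 0"
  shows "finite {g \<in> carrier G. d (\<alpha> g x) \<one> \<ge> \<eta>}"
proof -
  have "\<forall>\<^sub>F g in inf cofinite (principal (carrier G)). d (\<alpha> g x) \<one> < \<eta>"
    using assms unfolding homoclinic_group_def compatible[symmetric] limitin_metric
    by (auto elim: eventually_mono)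
  then show ?thesis
    by (simp add: eventually_inf_principal eventually_cofinite not_less Collect_conj_eq)
qed

subsection \<open>Products of translated homoclinic points\<close>

text \<open>Applying \<open>\<alpha> t\<close> turns the factor with index \<open>t\<close> back
  into \<open>x t\<close>. The index is a list because \<open>X\<close> need not be abelian.\<close>

definition orbit_product :: "('g \<Rightarrow> 'x) \<Rightarrow> 'g list \<Rightarrow> 'x" where
  "orbit_product x ts = foldr (\<lambda>t y. \<alpha> (inv\<^bsub>G\<^esub> t) (x t) \<otimes> y) ts \<one>"

definition separated :: "'g set \<Rightarrow> 'g set \<Rightarrow> bool" where
  "separated K J \<longleftrightarrow> J \<subseteq> carrier G \<and>
     (\<forall>t\<in>J. \<forall>t'\<in>J. \<forall>k\<in>K. \<forall>k'\<in>K. k \<otimes>\<^bsub>G\<^esub> t = k' \<otimes>\<^bsub>G\<^esub> t' \<longrightarrow> t = t')"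

lemma separated_subset: "separated K J \<Longrightarrow> I \<subseteq> J \<Longrightarrow> separated K I"
  unfolding separated_def by blast

lemma separated_unique:
  "separated K J \<Longrightarrow> t \<in> J \<Longrightarrow> t' \<in> J \<Longrightarrow> k \<in> K \<Longrightarrow> k' \<in> K \<Longrightarrow>
     k \<otimes>\<^bsub>G\<^esub> t = k' \<otimes>\<^bsub>G\<^esub> t' \<Longrightarrow> t = t'"
  unfolding separated_def by blast

lemma orbit_product_Nil [simp]: "orbit_product x [] = \<one>"
  and orbit_product_Cons [simp]:
    "orbit_product x (t # ts) = \<alpha> (inv\<^bsub>G\<^esub> t) (x t) \<otimes> orbit_product x ts"
  by (simp_all add: orbit_product_def)

lemma orbit_product_closed [simp]:
  "set ts \<subseteq> carrier G \<Longrightarrow> x ` set ts \<subseteq> carrier X \<Longrightarrow> orbit_product x ts \<in> carrier X"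
  by (induction ts) auto

lemma orbit_product_append:
  "set (ts @ us) \<subseteq> carrier G \<Longrightarrow> x ` set (ts @ us) \<subseteq> carrier X \<Longrightarrow>
     orbit_product x (ts @ us) = orbit_product x ts \<otimes> orbit_product x us"
proof (induction ts)
  case (Cons t ts)
  have "orbit_product x ts \<in> carrier X" "orbit_product x us \<in> carrier X"
    using Cons.prems by (auto intro!: orbit_product_closed)
  then show ?case
    using Cons by (simp add: m_assoc)
qed (simp add: orbit_product_closed)

text \<open>Applying \<open>s\<close> to the factor with index \<open>t s\<close> cancels
  \<open>s\<close>, leaving the factor with index \<open>t\<close>. In the sofic construction this
  compares the products built at the vertices \<open>v\<close> and
  \<open>\<sigma> s v\<close>.\<close>

lemma act_orbit_product:
  assumes "s \<in> carrier G" "set ts \<subseteq> carrier G" "x ` set ts \<subseteq> carrier X"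
    and "\<And>t. t \<in> set ts \<Longrightarrow> x' (t \<otimes>\<^bsub>G\<^esub> s) = x t"
  shows "\<alpha> s (orbit_product x' (map (\<lambda>t. t \<otimes>\<^bsub>G\<^esub> s) ts)) = orbit_product x ts"
  using assms
proof (induction ts)
  case (Cons t ts)
  have X: "x t \<in> carrier X" "t \<in> carrier G" "set ts \<subseteq> carrier G" "x ` set ts \<subseteq> carrier X"
    using Cons.prems by auto
  have cl: "orbit_product x' (map (\<lambda>t. t \<otimes>\<^bsub>G\<^esub> s) ts) \<in> carrier X"
    using Cons.prems by (intro orbit_product_closed) auto
  have "s \<otimes>\<^bsub>G\<^esub> inv\<^bsub>G\<^esub> (t \<otimes>\<^bsub>G\<^esub> s) = inv\<^bsub>G\<^esub> t"
    using Cons.prems(1) X(2) by (simp add: G.inv_mult_group flip: G.m_assoc)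
  then have "\<alpha> s (\<alpha> (inv\<^bsub>G\<^esub> (t \<otimes>\<^bsub>G\<^esub> s)) (x t)) = \<alpha> (inv\<^bsub>G\<^esub> t) (x t)"
    using Cons.prems(1) X by (simp add: act_act)
  moreover have "\<alpha> s (orbit_product x' (map (\<lambda>t. t \<otimes>\<^bsub>G\<^esub> s) ts)) = orbit_product x ts"
    using Cons by simp
  ultimately show ?case
    using Cons.prems X cl by (simp add: act_mult)
qed simp

text \<open>The orders in which \<open>ts\<close> and \<open>us\<close> list their elements need not be compatible.\<close>

definition window_determines ::
    "'g set \<Rightarrow> 'x set \<Rightarrow> 'g set \<Rightarrow> real \<Rightarrow> 'g set \<Rightarrow> bool" where
  "window_determines K P S \<delta> D \<longleftrightarrow>
     (\<forall>x ts y us. distinct ts \<longrightarrow> distinct us \<longrightarrow>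
        separated K (set ts) \<longrightarrow> separated K (set us) \<longrightarrow>
        x ` set ts \<subseteq> P \<longrightarrow> y ` set us \<subseteq> P \<longrightarrow> set ts \<inter> D = set us \<inter> D \<longrightarrow>
        (\<forall>t\<in>set ts \<inter> D. x t = y t) \<longrightarrow>
        (\<forall>g\<in>S. d (\<alpha> g (orbit_product x ts)) (\<alpha> g (orbit_product y us)) < \<delta>))"

text \<open>The order of choices matters: \<open>K\<close> is fixed before \<open>S\<close> and
  \<open>\<delta>\<close>, so a finer comparison of two products enlarges only the window
  \<open>D\<close> and leaves the required separation unchanged.\<close>

lemma shadowing:
  assumes P: "finite P" "P \<subseteq> homoclinic" and "\<epsilon> > 0"
  obtains K where "finite K" "K \<subseteq> carrier G" "\<one>\<^bsub>G\<^esub> \<in> K"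
    "\<And>x ts t. distinct ts \<Longrightarrow> separated K (set ts) \<Longrightarrow> x ` set ts \<subseteq> P \<Longrightarrow> t \<in> set ts \<Longrightarrow>
       d (\<alpha> t (orbit_product x ts)) (x t) < \<epsilon>"
    "\<And>S \<delta>. finite S \<Longrightarrow> S \<subseteq> carrier G \<Longrightarrow> \<delta> > 0 \<Longrightarrow>
       \<exists>D. finite D \<and> D \<subseteq> carrier G \<and> window_determines K P S \<delta> D"
proof -
  \<comment> \<open>With \<open>\<epsilon>'\<close> and \<open>\<eta>\<close> both at most
    \<open>c/2\<close>, any two such errors add up to at most \<open>c\<close>, the threshold of
    \<open>expansive_window\<close>.\<close>
  define \<epsilon>' where "\<epsilon>' = min \<epsilon> (c/2)"
  have \<epsilon>': "\<epsilon>' > 0" "\<epsilon>' \<le> \<epsilon>" "\<epsilon>' \<le> c/2"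
    using assms c_pos by (auto simp: \<epsilon>'_def)
  obtain \<eta>0 where \<eta>0: "\<eta>0 > 0"
    "\<And>a b b'. a \<in> carrier X \<Longrightarrow> b \<in> carrier X \<Longrightarrow> b' \<in> carrier X \<Longrightarrow> d a \<one> < \<eta>0 \<Longrightarrow> d b' \<one> < \<eta>0 \<Longrightarrow>
       d (a \<otimes> b \<otimes> b') b < \<epsilon>'"
    using uniform_mult[OF \<epsilon>'(1)] by blast
  define \<eta> where "\<eta> = min \<eta>0 (c/2)"
  have \<eta>: "\<eta> > 0" "\<eta> \<le> c/2"
    "\<And>a b b'. a \<in> carrier X \<Longrightarrow> b \<in> carrier X \<Longrightarrow> b' \<in> carrier X \<Longrightarrow> d a \<one> < \<eta> \<Longrightarrow> d b' \<one> < \<eta> \<Longrightarrow>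
       d (a \<otimes> b \<otimes> b') b < \<epsilon>'"
    using \<eta>0 c_pos by (auto simp: \<eta>_def)
  \<comment> \<open>On \<open>W\<close>, closeness \<open>c\<close> improves to closeness
    \<open>\<eta>\<close>, which is what \<open>uniform_mult\<close> takes as input; this closes the
    induction below.\<close>
  obtain W where W: "finite W" "W \<subseteq> carrier G"
    "\<And>x y. x \<in> carrier X \<Longrightarrow> y \<in> carrier X \<Longrightarrow> (\<And>w. w \<in> W \<Longrightarrow> d (\<alpha> w x) (\<alpha> w y) \<le> c) \<Longrightarrow> d x y < \<eta>"
    using expansive_window[OF \<eta>(1)] by blast
  have PX: "P \<subseteq> carrier X"
    using P homoclinic_subset by blast
  define K0 where "K0 = (\<Union>p\<in>P. {g \<in> carrier G. d (\<alpha> g p) \<one> \<ge> \<eta>})"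
  have K0: "finite K0" "K0 \<subseteq> carrier G"
    using P homoclinic_finite[OF _ \<eta>(1)] by (auto simp: K0_def)
  have K0_near: "d (\<alpha> g p) \<one> < \<eta>" if "g \<in> carrier G" "g \<notin> K0" "p \<in> P" for g p
    using that by (auto simp: K0_def not_le[symmetric])
  \<comment> \<open>\<open>K\<close> contains the products of inverses of elements of
    \<open>W\<close> with elements of \<open>K0\<close>: if \<open>g\<close> lies outside
    \<open>K t\<close>, then \<open>w g\<close> lies outside \<open>K0 t\<close> for all
    \<open>w \<in> W\<close>.\<close>
  define K where "K = insert \<one>\<^bsub>G\<^esub> ((\<lambda>(w, k). inv\<^bsub>G\<^esub> w \<otimes>\<^bsub>G\<^esub> k) ` (W \<times> K0))"
  have K: "finite K" "K \<subseteq> carrier G" "\<one>\<^bsub>G\<^esub> \<in> K"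
    using W(1,2) K0 by (auto simp: K_def subset_iff)
  have K_window: "w \<otimes>\<^bsub>G\<^esub> g \<otimes>\<^bsub>G\<^esub> inv\<^bsub>G\<^esub> t \<notin> K0"
    if "w \<in> W" "g \<in> carrier G" "t \<in> carrier G" "\<And>k. k \<in> K \<Longrightarrow> g \<noteq> k \<otimes>\<^bsub>G\<^esub> t" for w g t
  proof
    assume "w \<otimes>\<^bsub>G\<^esub> g \<otimes>\<^bsub>G\<^esub> inv\<^bsub>G\<^esub> t \<in> K0"
    then have "inv\<^bsub>G\<^esub> w \<otimes>\<^bsub>G\<^esub> (w \<otimes>\<^bsub>G\<^esub> g \<otimes>\<^bsub>G\<^esub> inv\<^bsub>G\<^esub> t) \<in> K"
      using that(1) by (force simp: K_def)
    moreover have "inv\<^bsub>G\<^esub> w \<otimes>\<^bsub>G\<^esub> (w \<otimes>\<^bsub>G\<^esub> g \<otimes>\<^bsub>G\<^esub> inv\<^bsub>G\<^esub> t) \<otimes>\<^bsub>G\<^esub> t = g"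
    proof -
      have "w \<in> carrier G" using W that by blast
      then show ?thesis
        using that(2,3) by (simp add: G.m_assoc G.inv_solve_left')
    qed
    ultimately show False
      using that(4) by metis
  qed
  define near where "near ts x g \<longleftrightarrow> d (\<alpha> g (orbit_product x ts)) \<one> < \<eta>" for ts x g
  define avoids where "avoids g J \<longleftrightarrow> (\<forall>t\<in>J. \<forall>k\<in>K. g \<noteq> k \<otimes>\<^bsub>G\<^esub> t)" for g J
  \<comment> \<open>By separation a group element lies in at most one translate \<open>K t\<close>,
    so it avoids all the other factors.\<close>
  have avoids_rest: "avoids (k \<otimes>\<^bsub>G\<^esub> t) (set as \<union> set bs)"
    if "distinct (as @ t # bs)" "separated K (set (as @ t # bs))" "k \<in> K" for as t bs k
    unfolding avoids_def
  proof (intro ballI notI)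
    fix t' k'
    assume t': "t' \<in> set as \<union> set bs" "k' \<in> K" "k \<otimes>\<^bsub>G\<^esub> t = k' \<otimes>\<^bsub>G\<^esub> t'"
    then have "t = t'"
      using that by (intro separated_unique[OF that(2), of t t' k k']) auto
    then show False
      using that(1) t'(1) by auto
  qed

  \<comment> \<open>The factors before and after \<open>t\<close> are collected into two products
    near the identity, which \<open>uniform_mult\<close> absorbs whatever the factor at
    \<open>t\<close> is.\<close>
  have split: "d (\<alpha> g (orbit_product x (ts @ t # us))) (\<alpha> (g \<otimes>\<^bsub>G\<^esub> inv\<^bsub>G\<^esub> t) (x t)) < \<epsilon>'"
    if "g \<in> carrier G" "set (ts @ t # us) \<subseteq> carrier G" "x ` set (ts @ t # us) \<subseteq> P"
      "near ts x g" "near us x g" for g x ts t us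
  proof -
    have X: "orbit_product x ts \<in> carrier X" "orbit_product x us \<in> carrier X" "t \<in> carrier G"
      "x t \<in> carrier X"
      using that PX by (auto intro!: orbit_product_closed)
    have "\<alpha> g (orbit_product x (ts @ t # us)) =
        \<alpha> g (orbit_product x ts) \<otimes> \<alpha> (g \<otimes>\<^bsub>G\<^esub> inv\<^bsub>G\<^esub> t) (x t) \<otimes> \<alpha> g (orbit_product x us)"
    proof -
      have "orbit_product x (ts @ t # us) =
          orbit_product x ts \<otimes> orbit_product x (t # us)"
        using that PX by (intro orbit_product_append) auto
      then show ?thesis
        using X that(1) by (simp add: act_mult act_act m_assoc)
    qed
    then show ?thesis
      using \<eta>(3)[of "\<alpha> g (orbit_product x ts)" "\<alpha> (g \<otimes>\<^bsub>G\<^esub> inv\<^bsub>G\<^esub> t) (x t)" "\<alpha> g (orbit_product x us)"]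
        that(1,4,5) X by (simp add: near_def)
  qed

  \<comment> \<open>The induction must vary \<open>g\<close> as well, since it is applied to
    sublists at the translates \<open>w g\<close>.\<close>
  have near: "near ts x g"
    if "distinct ts" "separated K (set ts)" "x ` set ts \<subseteq> P" "g \<in> carrier G" "avoids g (set ts)"
    for ts x g
    using that
  proof (induction "length ts" arbitrary: ts g rule: less_induct)
    case less
    note IH = less.hyps and prems = less.prems
    have tsG: "set ts \<subseteq> carrier G"
      using prems(2) by (simp add: separated_def)
    have YX: "orbit_product x ts \<in> carrier X"
      using prems tsG PX by (intro orbit_product_closed) auto
    show ?case
    proof (cases "ts = []")
      case True
      then show ?thesis
        using prems(4) \<eta>(1) by (simp add: near_def)
    next
      case False
      \<comment> \<open>Only \<open>K0 t\<close> is excluded here, so \<open>h\<close> may lie in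
        one translate \<open>K t\<close>. That \<open>t\<close> is then split off; otherwise the
        head of the list is. In both cases \<open>h\<close> avoids the two remaining, shorter lists,
        and the factor split off is itself near the identity.\<close>
      have "d (\<alpha> h (orbit_product x ts)) \<one> \<le> c"
        if h: "h \<in> carrier G" "\<And>t. t \<in> set ts \<Longrightarrow> h \<otimes>\<^bsub>G\<^esub> inv\<^bsub>G\<^esub> t \<notin> K0" for h
      proof -
        obtain as t bs where ts: "ts = as @ t # bs" and av: "avoids h (set as \<union> set bs)"
        proof (cases "\<exists>t\<in>set ts. \<exists>k\<in>K. h = k \<otimes>\<^bsub>G\<^esub> t")
          case True
          then obtain t k where tk: "t \<in> set ts" "k \<in> K" "h = k \<otimes>\<^bsub>G\<^esub> t"
            by blast
          then obtain as bs where ts: "ts = as @ t # bs"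
            by (meson split_list)
          then have "avoids h (set as \<union> set bs)"
            using prems(1,2) tk(2,3) avoids_rest by simp
          then show ?thesis
            using that ts by blast
        next
          case no: False
          obtain t bs where ts: "ts = [] @ t # bs"
            using False by (cases ts) auto
          show ?thesis
            using no by (intro that[OF ts]) (auto simp: avoids_def ts)
        qed
        have "near as x h" "near bs x h"
          using prems av h(1) unfolding ts
          by (intro IH; auto simp: ts avoids_def elim: separated_subset)+
        then have "d (\<alpha> h (orbit_product x ts)) (\<alpha> (h \<otimes>\<^bsub>G\<^esub> inv\<^bsub>G\<^esub> t) (x t)) < \<epsilon>'"
          using split[of h as t bs x] h(1) tsG prems(3) by (simp add: ts)
        moreover have "d (\<alpha> (h \<otimes>\<^bsub>G\<^esub> inv\<^bsub>G\<^esub> t) (x t)) \<one> < \<eta>"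
          using h tsG prems(3) by (intro K0_near) (auto simp: ts)
        moreover have "\<alpha> (h \<otimes>\<^bsub>G\<^esub> inv\<^bsub>G\<^esub> t) (x t) \<in> carrier X"
          using h(1) tsG prems(3) PX by (intro act_closed) (auto simp: ts)
        ultimately show ?thesis
          using triangle[of "\<alpha> h (orbit_product x ts)" "\<alpha> (h \<otimes>\<^bsub>G\<^esub> inv\<^bsub>G\<^esub> t) (x t)" \<one>] YX h(1)
            \<epsilon>'(3) \<eta>(2) by simp
      qed
      then have "d (\<alpha> (w \<otimes>\<^bsub>G\<^esub> g) (orbit_product x ts)) \<one> \<le> c" if "w \<in> W" for w
        using that K_window[OF that prems(4)] prems(4,5) W(2) tsG
        by (auto simp: avoids_def subset_iff)
      then have "d (\<alpha> g (orbit_product x ts)) \<one> < \<eta>"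
        using YX prems(4) W(2) by (intro W(3)) (auto simp: act_act subset_iff)
      then show ?thesis
        by (simp add: near_def)
    qed
  qed

  \<comment> \<open>Unlike in \<open>near\<close>, the factor at \<open>t\<close> may now be far
    from the identity, and the product follows it.\<close>
  have hit: "d (\<alpha> g (orbit_product x ts)) (\<alpha> (g \<otimes>\<^bsub>G\<^esub> inv\<^bsub>G\<^esub> t) (x t)) < \<epsilon>'"
    if A: "distinct ts" "separated K (set ts)" "x ` set ts \<subseteq> P" "t \<in> set ts" "k \<in> K" "g = k \<otimes>\<^bsub>G\<^esub> t"
    for ts x g t k
  proof -
    obtain as bs where ts: "ts = as @ t # bs"
      using A(4) by (meson split_list)
    have tsG: "set ts \<subseteq> carrier G"
      using A(2) by (simp add: separated_def)
    have g: "g \<in> carrier G"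
      using A tsG K(2) by auto
    have av: "avoids g (set as \<union> set bs)"
      using A(1,2,5,6) avoids_rest by (simp add: ts)
    have "near as x g" "near bs x g"
      using A(1-3) av g by (auto simp: ts avoids_def intro!: near elim: separated_subset)
    then show ?thesis
      using split[of g as t bs x] g tsG A(3) by (simp add: ts)
  qed

  show ?thesis
  proof
    fix x ts t
    assume A: "distinct ts" "separated K (set ts)" "x ` set ts \<subseteq> P" "t \<in> set ts"
    then have "t \<in> carrier G" "x t \<in> carrier X"
      using PX by (auto simp: separated_def)
    then show "d (\<alpha> t (orbit_product x ts)) (x t) < \<epsilon>"
      using hit[OF A K(3), of t] \<epsilon>'(2) by simp
  next
    fix S \<delta>
    assume S: "finite S" "S \<subseteq> carrier G" and "\<delta> > (0::real)"
    obtain V where V: "finite V" "V \<subseteq> carrier G"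
      "\<And>x y. x \<in> carrier X \<Longrightarrow> y \<in> carrier X \<Longrightarrow> (\<And>w. w \<in> V \<Longrightarrow> d (\<alpha> w x) (\<alpha> w y) \<le> c) \<Longrightarrow> d x y < \<delta>"
      using expansive_window[OF \<open>\<delta> > 0\<close>] by blast
    \<comment> \<open>\<open>D\<close> contains every \<open>t\<close> for which some
      \<open>v g\<close>, with \<open>v \<in> V\<close> and \<open>g \<in> S\<close>, lies in
      \<open>K t\<close>: no other factor can be felt at these places.\<close>
    define D where "D = (\<lambda>(k, v, g). inv\<^bsub>G\<^esub> k \<otimes>\<^bsub>G\<^esub> (v \<otimes>\<^bsub>G\<^esub> g)) ` (K \<times> V \<times> S)"
    have D: "finite D" "D \<subseteq> carrier G"
      using S V(1,2) K by (auto simp: D_def subset_iff)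
    have in_D: "t \<in> D" if "v \<in> V" "g \<in> S" "k \<in> K" "t \<in> carrier G" "v \<otimes>\<^bsub>G\<^esub> g = k \<otimes>\<^bsub>G\<^esub> t" for v g k t
    proof -
      have "k \<in> carrier G"
        using K that by blast
      then have "t = inv\<^bsub>G\<^esub> k \<otimes>\<^bsub>G\<^esub> (v \<otimes>\<^bsub>G\<^esub> g)"
        using that(4,5) by (simp flip: G.m_assoc)
      then show ?thesis
        unfolding D_def using that by force
    qed
    have "d (\<alpha> g (orbit_product x ts)) (\<alpha> g (orbit_product y us)) < \<delta>"
      if A: "distinct ts" "separated K (set ts)" "x ` set ts \<subseteq> P"
        and B: "distinct us" "separated K (set us)" "y ` set us \<subseteq> P"
        and eq: "set ts \<inter> D = set us \<inter> D" "\<And>t. t \<in> set ts \<inter> D \<Longrightarrow> x t = y t" and g: "g \<in> S"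
      for x ts y us g
    proof -
      have sub: "set ts \<subseteq> carrier G" "set us \<subseteq> carrier G"
        using A B by (auto simp: separated_def)
      have YX: "orbit_product x ts \<in> carrier X" "orbit_product y us \<in> carrier X"
        using A B sub PX by (auto intro!: orbit_product_closed)
      have gG: "g \<in> carrier G"
        using g S by blast
      have "d (\<alpha> v (\<alpha> g (orbit_product x ts))) (\<alpha> v (\<alpha> g (orbit_product y us))) \<le> c"
        if v: "v \<in> V" for v
      proof -
        define h where "h = v \<otimes>\<^bsub>G\<^esub> g"
        have h: "h \<in> carrier G" "\<alpha> h (orbit_product x ts) \<in> carrier X"
          "\<alpha> h (orbit_product y us) \<in> carrier X"
          using v V(2) gG YX by (auto simp: h_def)
        have "d (\<alpha> h (orbit_product x ts)) (\<alpha> h (orbit_product y us)) \<le> c"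
        proof (cases "\<exists>t\<in>set ts \<union> set us. \<exists>k\<in>K. h = k \<otimes>\<^bsub>G\<^esub> t")
          case True
          then obtain t k where t: "t \<in> set ts \<union> set us" and k: "k \<in> K" "h = k \<otimes>\<^bsub>G\<^esub> t"
            by blast
          \<comment> \<open>Hence \<open>t\<close> indexes the same factor in both lists, and both
            products are close to its image \<open>b\<close>, regardless of order and of the other
            factors.\<close>
          have "t \<in> D"
            using in_D[OF v g k(1)] t k(2) sub by (auto simp: h_def)
          then have t': "t \<in> set ts" "t \<in> set us" "x t = y t"
            using t eq by auto
          define b where "b = \<alpha> (h \<otimes>\<^bsub>G\<^esub> inv\<^bsub>G\<^esub> t) (x t)"
          have "b \<in> carrier X"
            using h(1) t'(1) sub(1) A(3) PX unfolding b_def by (intro act_closed) auto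
          moreover have "d (\<alpha> h (orbit_product x ts)) b < \<epsilon>'"
            unfolding b_def by (rule hit[OF A t'(1) k])
          moreover have "d (\<alpha> h (orbit_product y us)) b < \<epsilon>'"
            unfolding b_def t'(3) by (rule hit[OF B t'(2) k])
          ultimately show ?thesis
            using triangle'[of "\<alpha> h (orbit_product x ts)" b "\<alpha> h (orbit_product y us)"] h \<epsilon>'(3) by simp
        next
          case False
          then have "near ts x h" "near us y h"
            using A B h(1) by (auto intro!: near simp: avoids_def)
          then show ?thesis
            using triangle'[of "\<alpha> h (orbit_product x ts)" \<one> "\<alpha> h (orbit_product y us)"] h \<eta>(2)
            by (simp add: near_def)
        qed
        then show ?thesis
          using v V(2) gG YX by (auto simp: act_act h_def subset_iff)
      qed
      then show ?thesis
        using YX gG by (intro V(3)) auto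
    qed
    then show "\<exists>D. finite D \<and> D \<subseteq> carrier G \<and> window_determines K P S \<delta> D"
      using D by (intro exI[of _ D]) (simp add: window_determines_def)
  qed (use K in auto)
qed

subsection \<open>Naive independence and entropy\<close>

text \<open>Every \<open>K\<close>-separated set is independent, by shadowing. The greedy choice
  finds separated sets of density \<open>1 / card (K \<times> K)\<close>, because \<open>K a\<close>
  and \<open>K b\<close> meet for at most that many \<open>b\<close>.\<close>

lemma orbit_independence:
  assumes x: "\<And>j. j \<in> {1..k} \<Longrightarrow> x j \<in> homoclinic" and "\<epsilon> > 0"
    and A: "\<And>j. j \<in> {1..k} \<Longrightarrow> mball (x j) \<epsilon> \<subseteq> A j"
  obtains q where "q > 0"
    "\<And>F. finite F \<Longrightarrow> F \<subseteq> carrier G \<Longrightarrow>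
      \<exists>J\<subseteq>F. independence_set (carrier X) \<alpha> k A J \<and> q * real (card F) \<le> real (card J)"
proof -
  obtain K where K: "finite K" "K \<subseteq> carrier G" "\<one>\<^bsub>G\<^esub> \<in> K"
    and close: "\<And>y ts t. distinct ts \<Longrightarrow> separated K (set ts) \<Longrightarrow> y ` set ts \<subseteq> x ` {1..k} \<Longrightarrow>
       t \<in> set ts \<Longrightarrow> d (\<alpha> t (orbit_product y ts)) (y t) < \<epsilon>"
    using shadowing[of "x ` {1..k}" \<epsilon>] x \<open>\<epsilon> > 0\<close> by (metis (full_types) finite_atLeastAtMost finite_imageI image_subsetI)
  have indep: "independence_set (carrier X) \<alpha> k A J" if J: "separated K J" for J
    unfolding independence_set_def
  proof (intro allI impI)
    fix I \<phi> assume I: "I \<subseteq> J \<and> finite I \<and> I \<noteq> {} \<and> \<phi> \<in> I \<rightarrow> {1..k}"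
    obtain ts where ts: "set ts = I" "distinct ts"
      using I finite_distinct_list by blast
    define y where "y = orbit_product (\<lambda>t. x (\<phi> t)) ts"
    have sep: "separated K I"
      using J I separated_subset by blast
    have X: "x (\<phi> s) \<in> carrier X" if "s \<in> I" for s
      using I that x homoclinic_subset by blast
    have y: "y \<in> carrier X"
      using sep X unfolding y_def
      by (intro orbit_product_closed) (auto simp: ts separated_def)
    have "\<alpha> s y \<in> A (\<phi> s)" if s: "s \<in> I" for s
    proof -
      have "d (\<alpha> s y) (x (\<phi> s)) < \<epsilon>"
        unfolding y_def using sep I s by (intro close) (auto simp: ts)
      then have "\<alpha> s y \<in> mball (x (\<phi> s)) \<epsilon>"
        using X[OF s] y s sep by (auto simp: commute separated_def)
      then show ?thesis
        using A[of "\<phi> s"] I s by blast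
    qed
    then have "y \<in> (\<Inter>s\<in>I. {x \<in> carrier X. \<alpha> s x \<in> A (\<phi> s)})"
      using y by blast
    then show "(\<Inter>s\<in>I. {x \<in> carrier X. \<alpha> s x \<in> A (\<phi> s)}) \<noteq> {}"
      by blast
  qed
  define m where "m = card (K \<times> K)"
  have m: "m > 0"
    using K by (auto simp: m_def card_gt_0_iff)
  show ?thesis
  proof
    show "1 / real m > 0"
      using m by simp
    fix F assume F: "finite F" "F \<subseteq> carrier G"
    define R where "R a b \<longleftrightarrow> (\<exists>k\<in>K. \<exists>k'\<in>K. k \<otimes>\<^bsub>G\<^esub> a = k' \<otimes>\<^bsub>G\<^esub> b)" for a b
    have deg: "card {b \<in> F. b = a \<or> R a b \<or> R b a} \<le> m" if a: "a \<in> F" for a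
    proof -
      have "{b \<in> F. b = a \<or> R a b \<or> R b a} \<subseteq>
          (\<lambda>(k, k'). inv\<^bsub>G\<^esub> k \<otimes>\<^bsub>G\<^esub> (k' \<otimes>\<^bsub>G\<^esub> a)) ` (K \<times> K)"
      proof
        fix b assume b: "b \<in> {b \<in> F. b = a \<or> R a b \<or> R b a}"
        \<comment> \<open>\<open>R\<close> is symmetric, and it is reflexive because
          \<open>K\<close> contains the identity.\<close>
        then have "R b a"
          using K(3) by (auto simp: R_def) metis
        then obtain k k' where k: "k \<in> K" "k' \<in> K" "k \<otimes>\<^bsub>G\<^esub> b = k' \<otimes>\<^bsub>G\<^esub> a"
          by (auto simp: R_def)
        have "k \<in> carrier G" "b \<in> carrier G"
          using k(1) K(2) b F by auto
        then have "b = inv\<^bsub>G\<^esub> k \<otimes>\<^bsub>G\<^esub> (k' \<otimes>\<^bsub>G\<^esub> a)"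
          by (simp flip: k(3) G.m_assoc)
        then show "b \<in> (\<lambda>(k, k'). inv\<^bsub>G\<^esub> k \<otimes>\<^bsub>G\<^esub> (k' \<otimes>\<^bsub>G\<^esub> a)) ` (K \<times> K)"
          using k(1,2) by force
      qed
      then have "card {b \<in> F. b = a \<or> R a b \<or> R b a} \<le>
          card ((\<lambda>(k, k'). inv\<^bsub>G\<^esub> k \<otimes>\<^bsub>G\<^esub> (k' \<otimes>\<^bsub>G\<^esub> a)) ` (K \<times> K))"
        using K(1) by (intro card_mono) auto
      also have "\<dots> \<le> m"
        using K(1) unfolding m_def by (intro card_image_le) auto
      finally show ?thesis .
    qed
    obtain J where J: "J \<subseteq> F" "card F \<le> m * card J" "\<And>a b. a \<in> J \<Longrightarrow> b \<in> J \<Longrightarrow> R a b \<Longrightarrow> a = b"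
      using greedy_independent_subset[OF F(1) deg] by metis
    have "separated K J"
      using J(1,3) F(2) unfolding separated_def R_def by blast
    moreover have "1 / real m * real (card F) \<le> real (card J)"
      using J(2) m by (simp add: field_simps flip: of_nat_mult)
    ultimately show "\<exists>J\<subseteq>F. independence_set (carrier X) \<alpha> k A J \<and> 1 / real m * real (card F) \<le> real (card J)"
      using J(1) indep by blast
  qed
qed

text \<open>Density puts a homoclinic point into each \<open>U j\<close>, and the minimum over the
  finitely many coordinates gives a common radius.\<close>

lemma homoclinic_approximation:
  assumes dense: "T closure_of homoclinic = carrier X"
    and U: "\<And>j. j \<in> {1..k} \<Longrightarrow> openin T (U j) \<and> x j \<in> U j"
  obtains z \<epsilon> where "\<epsilon> > 0" "\<And>j. j \<in> {1..k::nat} \<Longrightarrow> z j \<in> homoclinic"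
    "\<And>j. j \<in> {1..k} \<Longrightarrow> mball (z j) \<epsilon> \<subseteq> U j"
proof -
  have "\<exists>z e. z \<in> homoclinic \<and> e > 0 \<and> mball z e \<subseteq> U j" if j: "j \<in> {1..k}" for j
  proof -
    have "x j \<in> T closure_of homoclinic"
      using U[OF j] dense openin_subset[of T "U j"] topspace_eq by auto
    then obtain z where z: "z \<in> homoclinic" "z \<in> U j"
      using U[OF j] by (auto simp: in_closure_of)
    then show ?thesis
      using U[OF j] unfolding compatible[symmetric] openin_mtopology by blast
  qed
  then obtain z e where z: "\<And>j. j \<in> {1..k} \<Longrightarrow> z j \<in> homoclinic"
    "\<And>j. j \<in> {1..k} \<Longrightarrow> e j > 0" "\<And>j. j \<in> {1..k} \<Longrightarrow> mball (z j) (e j) \<subseteq> U j"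
    by metis
  \<comment> \<open>The extra 1 keeps the minimum defined for \<open>k = 0\<close>.\<close>
  define \<epsilon> where "\<epsilon> = Min (insert 1 (e ` {1..k}))"
  have le: "\<epsilon> \<le> e j" if "j \<in> {1..k}" for j
    unfolding \<epsilon>_def using that by (intro Min_le) auto
  show ?thesis
  proof
    show "\<epsilon> > 0"
      using z(2) by (simp add: \<epsilon>_def)
    show "mball (z j) \<epsilon> \<subseteq> U j" if "j \<in> {1..k}" for j
      using mball_subset_concentric[OF le[OF that]] z(3)[OF that] by blast
  qed (rule z(1))
qed

lemma naive_UPE:
  assumes "T closure_of homoclinic = carrier X"
  shows "naive_UPE_all_orders G T \<alpha>"
  unfolding naive_UPE_all_orders_def
proof (intro allI impI)
  fix k :: nat assume "k \<ge> 2"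
  have "independence_density G (topspace T) \<alpha> k U > 0"
    if U: "\<forall>j\<in>{1..k}. openin T (U j) \<and> x j \<in> U j" for x U
  proof -
    obtain z \<epsilon> where z: "\<epsilon> > 0" "\<And>j. j \<in> {1..k} \<Longrightarrow> z j \<in> homoclinic"
      "\<And>j. j \<in> {1..k} \<Longrightarrow> mball (z j) \<epsilon> \<subseteq> U j"
      using homoclinic_approximation[OF assms, of k U x, OF bspec[OF U]] by metis
    obtain q where q: "q > 0" "\<And>F. finite F \<Longrightarrow> F \<subseteq> carrier G \<Longrightarrow>
      \<exists>J\<subseteq>F. independence_set (carrier X) \<alpha> k U J \<and> q * real (card F) \<le> real (card J)"
      using orbit_independence[where k = k and x = z and A = U, OF z(2,1,3)] by blast
    show ?thesis
      using independence_density_pos[OF G.one_closed q] topspace_eq by simp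
  qed
  then show "IE_tuples G T \<alpha> k = ({1..k} \<rightarrow>\<^sub>E topspace T)"
    by (auto simp: IE_tuples_def)
qed

text \<open>With \<open>r\<close> a third of the distance from the identity to another homoclinic
  point, the closed \<open>r\<close>-balls around the two stay \<open>r\<close> apart. Naive entropy
  uses that they are closed and disjoint, sofic entropy the gap.\<close>

lemma homoclinic_pair:
  assumes "homoclinic \<noteq> {\<one>}"
  obtains p r where "\<And>j. j \<in> {1..2::nat} \<Longrightarrow> p j \<in> homoclinic" "r > 0"
    "\<And>y z. y \<in> mcball (p 1) r \<Longrightarrow> z \<in> mcball (p 2) r \<Longrightarrow> r \<le> d y z"
proof -
  obtain x where x: "x \<in> homoclinic" "x \<noteq> \<one>"
    using assms one_homoclinic by blast
  then have X: "x \<in> carrier X"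
    using homoclinic_subset by blast
  define r where "r = d \<one> x / 3"
  define p where "p j = (if j = 1 then \<one> else x)" for j :: nat
  show ?thesis
  proof
    show "p j \<in> homoclinic" if "j \<in> {1..2}" for j
      using x one_homoclinic by (simp add: p_def)
    show "r > 0"
      using x X by (simp add: r_def)
    fix y z assume yz: "y \<in> mcball (p 1) r" "z \<in> mcball (p 2) r"
    then have "d \<one> x \<le> d \<one> y + d y z + d z x"
      using triangle[of \<one> y x] triangle[of y z x] by (auto simp: p_def)
    then show "r \<le> d y z"
      using yz by (simp add: p_def r_def commute)
  qed
qed

text \<open>The complements of two disjoint closed balls form a cover for which the rate is at least
  \<open>q * ln 2\<close> for every \<open>F\<close>, with \<open>q\<close> independent of
  \<open>F\<close>.\<close>

lemma naive_entropy_pos: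
  assumes "homoclinic \<noteq> {\<one>}"
  shows "naive_entropy G T \<alpha> > 0"
proof -
  obtain p r where p: "\<And>j. j \<in> {1..2::nat} \<Longrightarrow> p j \<in> homoclinic" "r > 0"
    "\<And>y z. y \<in> mcball (p 1) r \<Longrightarrow> z \<in> mcball (p 2) r \<Longrightarrow> r \<le> d y z"
    using homoclinic_pair[OF assms] by blast
  define A where "A j = mcball (p j) r" for j
  have "\<And>j. j \<in> {1..2} \<Longrightarrow> mball (p j) r \<subseteq> A j"
    by (auto simp: A_def mball_subset_mcball)
  then obtain q where q: "q > 0" "\<And>F. finite F \<Longrightarrow> F \<subseteq> carrier G \<Longrightarrow>
      \<exists>J\<subseteq>F. independence_set (carrier X) \<alpha> 2 A J \<and> q * real (card F) \<le> real (card J)"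
    using orbit_independence[where k = 2 and x = p and A = A, OF p(1,2)] by blast
  have disj: "A 1 \<inter> A 2 = {}"
    using p(2,3) by (fastforce simp: A_def)
  define \<U> where "\<U> = {carrier X - A 1, carrier X - A 2}"
  have "openin T (carrier X - A j)" for j
    using closedin_mcball[of "p j" r] compatible topspace_eq unfolding A_def closedin_def by metis
  then have cover: "open_cover T \<U>"
    using disj topspace_eq by (auto simp: open_cover_def \<U>_def)
  have "ereal (q * ln 2) \<le> ereal (ln (real (min_subcover_card (topspace T) (join_cover (topspace T) \<alpha> \<U> F)))
                 / real (card F))"
    if F: "finite F" "F \<noteq> {}" "F \<subseteq> carrier G" for F
  proof -
    obtain J where J: "J \<subseteq> F" "independence_set (carrier X) \<alpha> 2 A J" "q * real (card F) \<le> real (card J)"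
      using q(2) F by blast
    define N where "N = min_subcover_card (carrier X) (join_cover (carrier X) \<alpha> \<U> F)"
    have "2 ^ card J \<le> N"
      unfolding N_def \<U>_def using F by (intro min_subcover_card_join_ge J disj) auto
    then have "q * ln 2 \<le> ln (real N) / real (card F)"
      using J(3) F by (intro ln_rate_of_exponential) (auto simp: card_gt_0_iff)
    then show ?thesis
      using topspace_eq by (simp add: N_def)
  qed
  then have "ereal (q * ln 2) \<le> naive_entropy G T \<alpha>"
    unfolding naive_entropy_def using cover by (intro SUP_upper2[of \<U>] INF_greatest) auto
  moreover have "0 < ereal (q * ln 2)"
    using q(1) by simp
  ultimately show ?thesis
    by (rule order.strict_trans2[rotated])
qed

subsection \<open>Sofic independence and entropy\<close>

lemma bounded_diameter:
  obtains L where "\<And>x y. x \<in> carrier X \<Longrightarrow> y \<in> carrier X \<Longrightarrow> d x y \<le> L"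
proof -
  have "compactin mtopology (carrier X)"
    using compact topspace_eq by (simp add: compact_space_def compatible)
  then have "mbounded (carrier X)"
    by (rule compactin_imp_mbounded)
  then show ?thesis
    using that by (auto simp: mbounded_alt)
qed

text \<open>At a free vertex \<open>v\<close>, the map sending \<open>t\<close> to
  \<open>\<sigma> t v\<close> pulls a sparse vertex set \<open>J\<close> back to a
  \<open>K\<close>-separated set. The labels on \<open>J\<close> seen from \<open>v\<close> then
  define a product. Passing from \<open>v\<close> to \<open>\<sigma> s v\<close> translates the
  index set, and the resulting change of window and order is absorbed by
  \<open>window_determines\<close>.\<close>

lemma sofic_independence:
  assumes sofic: "sofic_approximation G n \<sigma>"
    and x: "\<And>j. j \<in> {1..k} \<Longrightarrow> x j \<in> homoclinic" and "\<epsilon> > 0"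
    and A: "\<And>j. j \<in> {1..k} \<Longrightarrow> mball (x j) \<epsilon> \<subseteq> A j"
  obtains q where "q > 0"
    "\<And>F \<delta>. finite F \<Longrightarrow> F \<subseteq> carrier G \<Longrightarrow> \<delta> > 0 \<Longrightarrow>
      \<forall>\<^sub>F i in sequentially. \<exists>J. sofic_independence_set (carrier X) d \<alpha> F \<delta> (n i) (\<sigma> i) k A J \<and>
        q * real (n i) \<le> real (card J)"
proof -
  define P where "P = x ` {1..k}"
  have P: "finite P" "P \<subseteq> homoclinic"
    using x by (auto simp: P_def)
  have PX: "P \<subseteq> carrier X"
    using P(2) homoclinic_subset by blast
  obtain K where K: "finite K" "K \<subseteq> carrier G" "\<one>\<^bsub>G\<^esub> \<in> K"
    and close: "\<And>y ts t. distinct ts \<Longrightarrow> separated K (set ts) \<Longrightarrow> y ` set ts \<subseteq> P \<Longrightarrow> t \<in> set ts \<Longrightarrow>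
       d (\<alpha> t (orbit_product y ts)) (y t) < \<epsilon>"
    and local: "\<And>S \<delta>. finite S \<Longrightarrow> S \<subseteq> carrier G \<Longrightarrow> \<delta> > 0 \<Longrightarrow>
       \<exists>D. finite D \<and> D \<subseteq> carrier G \<and> window_determines K P S \<delta> D"
    by (rule shadowing[OF P \<open>\<epsilon> > 0\<close>]) blast
  obtain L where L: "\<And>x y. x \<in> carrier X \<Longrightarrow> y \<in> carrier X \<Longrightarrow> d x y \<le> L"
    using bounded_diameter by blast
  have n: "filterlim n at_top sequentially"
    and perm: "\<And>i s. s \<in> carrier G \<Longrightarrow> \<sigma> i s permutes {1..n i}"
    using sofic by (auto simp: sofic_approximation_def)
  \<comment> \<open>Sparse means that no element of \<open>H\<close> moves one vertex of
    \<open>J\<close> to another.\<close>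
  define H where "H = (\<lambda>(k, k'). inv\<^bsub>G\<^esub> k' \<otimes>\<^bsub>G\<^esub> k) ` (K \<times> K)"
  have H: "finite H" "H \<subseteq> carrier G"
    using K by (auto simp: H_def subset_iff)
  \<comment> \<open>A vertex, its images and its preimages under \<open>H\<close>. This depends on
    \<open>K\<close> only, so the density does not depend on \<open>F\<close> and
    \<open>\<delta>\<close>.\<close>
  define m where "m = 2 * card H + 1"
  show ?thesis
  proof
    show "1 / (2 * real m) > 0"
      by (simp add: m_def)
    fix F and \<delta> :: real assume F: "finite F" "F \<subseteq> carrier G" and "\<delta> > 0"
    have "\<delta> / 2 > 0"
      using \<open>\<delta> > 0\<close> by simp
    from local[OF F this] obtain D0 where D0: "finite D0" "D0 \<subseteq> carrier G"
      and agree: "window_determines K P F (\<delta> / 2) D0"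
      by blast
    define shift where "shift s C = (\<lambda>t. t \<otimes>\<^bsub>G\<^esub> s) ` C" for s C
    \<comment> \<open>Chosen so that both \<open>D\<close> and each translate \<open>D s\<close>,
      the window at \<open>\<sigma> s v\<close> as seen from \<open>v\<close>, contain
      \<open>D0\<close>. The identity is included to read off the label at the vertex
      itself.\<close>
    define D where "D = insert \<one>\<^bsub>G\<^esub> (D0 \<union> (\<Union>s\<in>F. shift (inv\<^bsub>G\<^esub> s) D0))"
    define E where "E = D \<union> F \<union> H \<union> (\<Union>s\<in>F. shift s D)"
    have D: "finite D" "D \<subseteq> carrier G" "\<one>\<^bsub>G\<^esub> \<in> D" "D0 \<subseteq> D"
      using D0 F by (auto simp: D_def shift_def subset_iff)
    have D_shift: "D0 \<subseteq> shift s D" if s: "s \<in> F" for s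
    proof
      fix t assume t: "t \<in> D0"
      then have "t \<otimes>\<^bsub>G\<^esub> inv\<^bsub>G\<^esub> s \<in> D"
        using s by (auto simp: D_def shift_def)
      moreover have "t \<otimes>\<^bsub>G\<^esub> inv\<^bsub>G\<^esub> s \<otimes>\<^bsub>G\<^esub> s = t"
        using s t D0 F by (simp add: G.m_assoc subset_iff)
      ultimately show "t \<in> shift s D"
        unfolding shift_def by (metis imageI)
    qed
    have E: "finite E" "E \<subseteq> carrier G" "D \<subseteq> E" "F \<subseteq> E" "H \<subseteq> E"
      "\<And>s. s \<in> F \<Longrightarrow> shift s D \<subseteq> E"
      using D F H by (auto simp: E_def shift_def subset_iff)
    \<comment> \<open>If at most \<open>\<kappa> n\<close> vertices are not free, at least half of them are, and the others
      contribute at most \<open>\<delta>\<^sup>2 / 2\<close> to the mean square defect of equivariance.\<close>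
    define \<kappa> where "\<kappa> = min (1/2) (\<delta>\<^sup>2 / (2 * (L\<^sup>2 + 1)))"
    have L1: "L\<^sup>2 + 1 > 0"
      by (simp add: add_nonneg_pos)
    have \<kappa>: "\<kappa> > 0"
      using \<open>\<delta> > 0\<close> L1 by (auto simp: \<kappa>_def)
    have \<kappa>_le: "\<kappa> \<le> 1/2" "\<kappa> \<le> \<delta>\<^sup>2 / (2 * (L\<^sup>2 + 1))"
      by (simp_all only: \<kappa>_def min.cobounded1 min.cobounded2)
    have "\<kappa> * L\<^sup>2 \<le> \<kappa> * (L\<^sup>2 + 1)"
      using \<kappa> by (intro mult_left_mono) auto
    also have "\<dots> \<le> \<delta>\<^sup>2 / (2 * (L\<^sup>2 + 1)) * (L\<^sup>2 + 1)"
      using L1 \<kappa>_le(2) by (intro mult_right_mono) auto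
    also have "\<dots> = \<delta>\<^sup>2 / 2"
      using L1 by (simp add: field_simps)
    finally have \<kappa>L: "\<kappa> * L\<^sup>2 \<le> \<delta>\<^sup>2 / 2" .
    \<comment> \<open>The orders chosen at \<open>v\<close> and at \<open>\<sigma> s v\<close> are
      unrelated, which is why \<open>window_determines\<close> must tolerate incompatible
      orders.\<close>
    obtain enum :: "'g set \<Rightarrow> 'g list"
      where enum: "\<And>S. finite S \<Longrightarrow> set (enum S) = S" "\<And>S. finite S \<Longrightarrow> distinct (enum S)"
      using finite_distinct_list by metis

    have main: "\<exists>J. sofic_independence_set (carrier X) d \<alpha> F \<delta> (n i) (\<sigma> i) k A J \<and>
        1 / (2 * real m) * real (n i) \<le> real (card J)"
      if few: "real (card {v \<in> {1..n i}. \<not> free_vertex G E (\<sigma> i) v}) \<le> \<kappa> * real (n i)"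
        and pos: "n i > 0" for i
    proof -
      define B where "B = {v \<in> {1..n i}. \<not> free_vertex G E (\<sigma> i) v}"
      define V where "V = {v \<in> {1..n i}. free_vertex G E (\<sigma> i) v}"
      have VB: "V = {1..n i} - B" "B \<subseteq> {1..n i}" "finite V"
        by (auto simp: B_def V_def)
      have mult: "\<sigma> i (s \<otimes>\<^bsub>G\<^esub> t) v = \<sigma> i s (\<sigma> i t v)" if "v \<in> V" "s \<in> E" "t \<in> E" for s t v
        using that by (auto simp: V_def free_vertex_def)
      have free: "s = t" if "v \<in> V" "s \<in> E" "t \<in> E" "\<sigma> i s v = \<sigma> i t v" for s t v
        using that by (auto simp: V_def free_vertex_def)
      have in_n: "\<sigma> i s v \<in> {1..n i}" if "v \<in> {1..n i}" "s \<in> carrier G" for s v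
        using permutes_in_image[OF perm[OF that(2)]] that(1) by blast
      define R where "R a b \<longleftrightarrow> (\<exists>h\<in>H. \<sigma> i h a = b)" for a b
      have deg: "card {b \<in> V. b = a \<or> R a b \<or> R b a} \<le> m" if "a \<in> V" for a
      proof -
        \<comment> \<open>\<open>R\<close> need not be symmetric; the second set collects the
          vertices moved to \<open>a\<close>, one for each \<open>h\<close> because
          \<open>\<sigma> i h\<close> is a permutation.\<close>
        define U where "U = (\<lambda>h. \<sigma> i h a) ` H \<union> (\<lambda>h. Hilbert_Choice.inv (\<sigma> i h) a) ` H"
        have "{b \<in> V. b = a \<or> R a b \<or> R b a} \<subseteq> insert a U"
        proof
          fix b assume "b \<in> {b \<in> V. b = a \<or> R a b \<or> R b a}"
          then consider "b = a" | h where "h \<in> H" "\<sigma> i h a = b" | h where "h \<in> H" "\<sigma> i h b = a"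
            by (auto simp: R_def)
          then show "b \<in> insert a U"
          proof cases
            case 3
            then have "b = Hilbert_Choice.inv (\<sigma> i h) a"
              using permutes_inverses(2)[OF perm[of h i], of b] H(2) by auto
            then show ?thesis
              using 3(1) by (auto simp: U_def)
          qed (auto simp: U_def)
        qed
        moreover have "finite U"
          using H(1) by (simp add: U_def)
        ultimately have "card {b \<in> V. b = a \<or> R a b \<or> R b a} \<le> card (insert a U)"
          by (intro card_mono) auto
        also have "\<dots> \<le> Suc (card U)"
          using \<open>finite U\<close> by (simp add: card_insert_if)
        also have "card U \<le> card H + card H"
          unfolding U_def using H(1) by (intro card_Un_le[THEN order_trans] add_mono card_image_le)
        finally show ?thesis
          by (simp add: m_def)
      qed
      obtain J where J: "J \<subseteq> V" "card V \<le> m * card J" "\<And>a b. a \<in> J \<Longrightarrow> b \<in> J \<Longrightarrow> R a b \<Longrightarrow> a = b"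
        using greedy_independent_subset[OF VB(3) deg] by metis
      have "real (card V) = real (n i) - real (card B)"
        using VB card_mono[OF _ VB(2)] by (simp add: card_Diff_subset finite_subset of_nat_diff)
      moreover have "real (card B) \<le> 1/2 * real (n i)"
        using few mult_right_mono[OF \<kappa>_le(1), of "real (n i)"] by (simp add: B_def)
      ultimately have "real (n i) \<le> 2 * real (card V)"
        by linarith
      moreover have "real (card V) \<le> real m * real (card J)"
        using J(2) by (simp flip: of_nat_mult)
      moreover have "real m > 0"
        by (simp add: m_def)
      ultimately have card_J: "1 / (2 * real m) * real (n i) \<le> real (card J)"
        by (simp add: field_simps)
      \<comment> \<open>If \<open>K t\<close> and \<open>K t'\<close> meet, some
        \<open>h \<in> H\<close> moves \<open>\<sigma> t v\<close> to \<open>\<sigma> t' v\<close>.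
        Sparsity makes these vertices equal, and freeness gives \<open>t = t'\<close>.\<close>
      have sep: "separated K {t \<in> C. \<sigma> i t v \<in> J}" if C: "C \<subseteq> E" and v: "v \<in> V" for C v
        unfolding separated_def
      proof (intro conjI ballI impI)
        fix t t' k k'
        assume t: "t \<in> {t \<in> C. \<sigma> i t v \<in> J}" "t' \<in> {t \<in> C. \<sigma> i t v \<in> J}"
          and k: "k \<in> K" "k' \<in> K" "k \<otimes>\<^bsub>G\<^esub> t = k' \<otimes>\<^bsub>G\<^esub> t'"
        have tE: "t \<in> E" "t' \<in> E"
          using t C by auto
        have cG: "k \<in> carrier G" "k' \<in> carrier G" "t \<in> carrier G" "t' \<in> carrier G"
          using tE E(2) k K(2) by auto
        define h where "h = inv\<^bsub>G\<^esub> k' \<otimes>\<^bsub>G\<^esub> k"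
        have "h \<in> H"
          using k(1,2) by (force simp: H_def h_def)
        have "h \<otimes>\<^bsub>G\<^esub> t = t'"
          using cG k(3) by (simp add: h_def G.m_assoc G.inv_solve_left')
        then have "\<sigma> i h (\<sigma> i t v) = \<sigma> i t' v"
          using mult[OF v, of h t] \<open>h \<in> H\<close> E(5) tE by auto
        then have "\<sigma> i t v = \<sigma> i t' v"
          using t J(3) \<open>h \<in> H\<close> by (auto simp: R_def)
        then show "t = t'"
          using free[OF v tE] by blast
      qed (use C E(2) in auto)
      have "\<exists>\<phi>\<in>sofic_maps (carrier X) d \<alpha> F \<delta> (n i) (\<sigma> i). \<forall>a\<in>J. \<phi> a \<in> A (\<omega> a)"
        if \<omega>: "\<omega> \<in> J \<rightarrow> {1..k}" for \<omega>
      proof -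
        define label where "label v t = x (\<omega> (\<sigma> i t v))" for v t
        define hits where "hits v = {t \<in> D. \<sigma> i t v \<in> J}" for v
        define \<phi> where "\<phi> = restrict (\<lambda>v. orbit_product (label v) (enum (hits v))) {1..n i}"
        have hits: "finite (hits v)" "hits v \<subseteq> carrier G" for v
          using D by (auto simp: hits_def)
        have label: "label v ` hits v \<subseteq> P" for v
          using \<omega> by (auto simp: label_def hits_def P_def)
        \<comment> \<open>This holds at every vertex, so \<open>\<phi>\<close> is defined
          throughout; separation is available at free vertices only.\<close>
        have prod_X: "orbit_product (label v) (enum (hits v)) \<in> carrier X" for v
          using hits subset_trans[OF label PX] by (intro orbit_product_closed) (simp_all add: enum(1))
        have sep_hits: "separated K (hits v)" if "v \<in> V" for v
          unfolding hits_def by (rule sep[OF E(3) that])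
        have \<phi>: "\<phi> \<in> {1..n i} \<rightarrow>\<^sub>E carrier X"
          using prod_X by (auto simp: \<phi>_def)
        have "\<phi> a \<in> A (\<omega> a)" if a: "a \<in> J" for a
        proof -
          have aV: "a \<in> V" "a \<in> {1..n i}"
            using J(1) a by (auto simp: V_def)
          \<comment> \<open>The identity of \<open>G\<close> is not assumed to act trivially;
            multiplicativity at \<open>a\<close> and injectivity show that it fixes
            \<open>a\<close>.\<close>
          have "\<sigma> i \<one>\<^bsub>G\<^esub> (\<sigma> i \<one>\<^bsub>G\<^esub> a) = \<sigma> i \<one>\<^bsub>G\<^esub> a"
            using mult[OF aV(1), of "\<one>\<^bsub>G\<^esub>" "\<one>\<^bsub>G\<^esub>"] D(3) E(3) by auto
          then have fix_a: "\<sigma> i \<one>\<^bsub>G\<^esub> a = a"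
            using permutes_inj[OF perm[OF G.one_closed]] by (auto dest: injD)
          have one_hit: "\<one>\<^bsub>G\<^esub> \<in> hits a"
            using D(3) a fix_a by (simp add: hits_def)
          have "d (\<alpha> \<one>\<^bsub>G\<^esub> (orbit_product (label a) (enum (hits a)))) (label a \<one>\<^bsub>G\<^esub>) < \<epsilon>"
            using hits label sep_hits[OF aV(1)] one_hit by (intro close) (simp_all add: enum)
          then have "d (\<phi> a) (x (\<omega> a)) < \<epsilon>"
            using prod_X[of a] aV(2) fix_a by (simp add: \<phi>_def label_def)
          moreover have "x (\<omega> a) \<in> carrier X" "\<phi> a \<in> carrier X"
            using x \<omega> a homoclinic_subset \<phi> aV(2) by blast+
          ultimately have "\<phi> a \<in> mball (x (\<omega> a)) \<epsilon>"
            by (simp add: commute)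
          then show ?thesis
            using A \<omega> a by blast
        qed
        moreover have "\<phi> \<in> sofic_maps (carrier X) d \<alpha> F \<delta> (n i) (\<sigma> i)"
        proof (rule sofic_mapsI[where B = B and L = L])
          show "d (\<phi> (\<sigma> i s v)) (\<alpha> s (\<phi> v)) \<le> L" if "s \<in> F" "v \<in> {1..n i}" for s v
            using that F(2) by (intro L act_closed PiE_mem[OF \<phi>] in_n) auto
          have "real (card B) * L\<^sup>2 \<le> \<kappa> * real (n i) * L\<^sup>2"
            using few by (intro mult_right_mono) (auto simp: B_def)
          also have "\<dots> = real (n i) * (\<kappa> * L\<^sup>2)"
            by simp
          also have "\<dots> \<le> real (n i) * (\<delta>\<^sup>2 / 2)"
            using \<kappa>L by (intro mult_left_mono) auto
          finally show "real (card B) * L\<^sup>2 \<le> real (n i) * \<delta>\<^sup>2 / 2"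
            by simp
        next
          fix s v assume s: "s \<in> F" and "v \<in> {1..n i} - B"
          then have v: "v \<in> V" "v \<in> {1..n i}"
            using VB by auto
          have sG: "s \<in> carrier G"
            using s F by blast
          define w where "w = \<sigma> i s v"
          have w: "w \<in> {1..n i}"
            unfolding w_def by (rule in_n[OF v(2) sG])
          have ts: "\<sigma> i (t \<otimes>\<^bsub>G\<^esub> s) v = \<sigma> i t w" if "t \<in> D" for t
            unfolding w_def using mult[OF v(1)] that s E(3,4) by blast
          \<comment> \<open>The indices used at \<open>w\<close>, rewritten as indices based at
            \<open>v\<close>.\<close>
          define ts where "ts = map (\<lambda>t. t \<otimes>\<^bsub>G\<^esub> s) (enum (hits w))"
          have set_ts: "set ts = {u \<in> shift s D. \<sigma> i u v \<in> J}"
            unfolding ts_def set_map enum(1)[OF hits(1)] using ts by (auto simp: hits_def shift_def)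
          have "orbit_product (label w) (enum (hits w)) = \<alpha> s (orbit_product (label v) ts)"
            unfolding ts_def
          proof (rule act_orbit_product[symmetric])
            show "label v (t \<otimes>\<^bsub>G\<^esub> s) = label w t" if "t \<in> set (enum (hits w))" for t
            proof -
              have "t \<in> D"
                using that unfolding enum(1)[OF hits(1)] by (simp add: hits_def)
              then show ?thesis
                by (simp add: label_def ts)
            qed
          qed (use sG hits subset_trans[OF label PX] in \<open>simp_all add: enum(1)\<close>)
          moreover have "d (\<alpha> s (orbit_product (label v) ts))
              (\<alpha> s (orbit_product (label v) (enum (hits v)))) < \<delta> / 2"
          proof (rule agree[unfolded window_determines_def, rule_format])
            show "distinct ts"
              using hits(1,2)[of w] sG
              by (auto simp: ts_def distinct_map enum inj_on_def subset_iff)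
            show "label v ` set ts \<subseteq> P"
              using \<omega> by (auto simp: set_ts label_def P_def)
            show "set ts \<inter> D0 = set (enum (hits v)) \<inter> D0"
              unfolding set_ts enum(1)[OF hits(1)] using D(4) D_shift[OF s] by (auto simp: hits_def)
            show "separated K (set ts)"
              unfolding set_ts by (rule sep[OF E(6)[OF s] v(1)])
            show "separated K (set (enum (hits v)))"
              using sep_hits[OF v(1)] by (simp add: enum(1) hits)
          qed (use hits label s in \<open>auto simp: enum\<close>)
          ultimately show "d (\<phi> (\<sigma> i s v)) (\<alpha> s (\<phi> v)) \<le> \<delta> / 2"
            using v(2) w by (simp add: \<phi>_def flip: w_def)
        qed (use \<phi> pos VB \<open>\<delta> > 0\<close> in auto)
        ultimately show ?thesis
          by blast
      qed
      then show ?thesis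
        using card_J J(1) VB(1) unfolding sofic_independence_set_def by blast
    qed
    have "\<forall>\<^sub>F i in sequentially. n i > 0"
      using n unfolding filterlim_at_top by (auto elim: allE[of _ 1] simp: Suc_le_eq)
    with sofic_approximation_eventually_free[OF sofic E(1,2) \<kappa>]
    show "\<forall>\<^sub>F i in sequentially. \<exists>J. sofic_independence_set (carrier X) d \<alpha> F \<delta> (n i) (\<sigma> i) k A J \<and>
        1 / (2 * real m) * real (n i) \<le> real (card J)"
      by eventually_elim (rule main)
  qed
qed

section \<open>Separated families of maps and sofic entropy\<close>

text \<open>\<open>GREATEST\<close> needs an upper bound. For a finite set \<open>C\<close> of
  centres of \<open>\<epsilon> / 2\<close>-balls covering \<open>X\<close>, maps with the same
  centres at all vertices are less than \<open>\<epsilon>\<close> apart, so a separated family has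
  at most \<open>card C ^ n\<close> elements.\<close>

lemma max_separated_card_ge:
  assumes S: "S \<subseteq> Y" "finite S" and Y: "Y \<subseteq> {1..n} \<rightarrow>\<^sub>E carrier X" and "n > 0" "\<epsilon> > 0"
    and sep: "\<And>\<phi> \<psi>. \<phi> \<in> S \<Longrightarrow> \<psi> \<in> S \<Longrightarrow> \<phi> \<noteq> \<psi> \<Longrightarrow> \<exists>v\<in>{1..n}. \<epsilon> \<le> d (\<phi> v) (\<psi> v)"
  shows "card S \<le> max_separated_card d n \<epsilon> Y"
proof -
  have "mtotally_bounded (carrier X)"
    using compact topspace_eq compactin_imp_mtotally_bounded[of "carrier X"]
    by (simp add: compact_space_def compatible)
  from this[unfolded mtotally_bounded_def, rule_format, OF half_gt_zero[OF \<open>\<epsilon> > 0\<close>]]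
  obtain C where C: "finite C" "C \<subseteq> carrier X" "carrier X \<subseteq> (\<Union>x\<in>C. mball x (\<epsilon> / 2))"
    by (elim exE conjE) (rule that)
  then have "\<exists>z\<in>C. d z x < \<epsilon> / 2 \<and> z \<in> carrier X" if "x \<in> carrier X" for x
    using that by fastforce
  then obtain h where h: "\<And>x. x \<in> carrier X \<Longrightarrow> h x \<in> C \<and> d (h x) x < \<epsilon> / 2 \<and> h x \<in> carrier X"
    by metis
  have bound: "card E \<le> card C ^ n"
    if E: "E \<subseteq> Y" "finite E"
      and E_sep: "\<forall>\<phi>\<in>E. \<forall>\<psi>\<in>E. \<phi> \<noteq> \<psi> \<longrightarrow> \<epsilon> \<le> (MAX v\<in>{1..n}. d (\<phi> v) (\<psi> v))" for E
  proof -
    have EX: "\<phi> v \<in> carrier X" if "\<phi> \<in> E" "v \<in> {1..n}" for \<phi> v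
      using that E(1) Y by blast
    define H where "H \<phi> = restrict (\<lambda>v. h (\<phi> v)) {1..n}" for \<phi>
    have "inj_on H E"
    proof (rule inj_onI, rule ccontr)
      fix \<phi> \<psi> assume A: "\<phi> \<in> E" "\<psi> \<in> E" "H \<phi> = H \<psi>" "\<phi> \<noteq> \<psi>"
      have "d (\<phi> v) (\<psi> v) < \<epsilon>" if v: "v \<in> {1..n}" for v
      proof -
        have "h (\<phi> v) = h (\<psi> v)"
          using fun_cong[OF A(3), of v] v by (simp add: H_def)
        then show ?thesis
          using h[OF EX[OF A(1) v]] h[OF EX[OF A(2) v]] EX[OF A(1) v] EX[OF A(2) v]
            triangle''[of "\<phi> v" "h (\<phi> v)" "\<psi> v"] by simp
      qed
      then have "(MAX v\<in>{1..n}. d (\<phi> v) (\<psi> v)) < \<epsilon>"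
        using \<open>n > 0\<close> by (subst Max_less_iff) auto
      then show False
        using E_sep A by fastforce
    qed
    moreover have "H ` E \<subseteq> {1..n} \<rightarrow>\<^sub>E C"
      using h EX by (auto simp: H_def)
    ultimately have "card E \<le> card ({1..n} \<rightarrow>\<^sub>E C)"
      using C(1) by (intro card_inj_on_le) (auto intro: finite_PiE)
    then show ?thesis
      by (simp add: card_funcsetE)
  qed
  have "\<epsilon> \<le> (MAX v\<in>{1..n}. d (\<phi> v) (\<psi> v))" if "\<phi> \<in> S" "\<psi> \<in> S" "\<phi> \<noteq> \<psi>" for \<phi> \<psi>
  proof -
    obtain v where "v \<in> {1..n}" "\<epsilon> \<le> d (\<phi> v) (\<psi> v)"
      using \<open>\<phi> \<in> S\<close> \<open>\<psi> \<in> S\<close> \<open>\<phi> \<noteq> \<psi>\<close> sep by blast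
    then show ?thesis
      by (meson Max_ge finite_atLeastAtMost finite_imageI imageI order_trans)
  qed
  then show ?thesis
    unfolding max_separated_card_def
    by (intro Greatest_le_nat[where b = "card C ^ n"]) (use S bound in auto)
qed

lemma sofic_UPE:
  assumes "sofic_approximation G n \<sigma>" "T closure_of homoclinic = carrier X"
  shows "sofic_UPE_all_orders G T d \<alpha> n \<sigma>"
  unfolding sofic_UPE_all_orders_def
proof (intro allI impI)
  fix k :: nat assume "k \<ge> 2"
  have "positive_upper_independence_density G (topspace T) d \<alpha> n \<sigma> k U"
    if U: "\<forall>j\<in>{1..k}. openin T (U j) \<and> x j \<in> U j" for x U
  proof -
    obtain z \<epsilon> where z: "\<epsilon> > 0" "\<And>j. j \<in> {1..k} \<Longrightarrow> z j \<in> homoclinic"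
      "\<And>j. j \<in> {1..k} \<Longrightarrow> mball (z j) \<epsilon> \<subseteq> U j"
      using homoclinic_approximation[OF assms(2), of k U x, OF bspec[OF U]] by metis
    obtain q where q: "q > 0" "\<And>F \<delta>. finite F \<Longrightarrow> F \<subseteq> carrier G \<Longrightarrow> \<delta> > 0 \<Longrightarrow>
      \<forall>\<^sub>F i in sequentially. \<exists>J. sofic_independence_set (carrier X) d \<alpha> F \<delta> (n i) (\<sigma> i) k U J \<and>
        q * real (n i) \<le> real (card J)"
      using sofic_independence[where k = k and x = z and A = U, OF assms(1) z(2,1,3)] by blast
    \<comment> \<open>The independence sets exist for all large \<open>i\<close>, which is more than
      the upper density asks for.\<close>
    have "infinite {i. P i}" if "\<forall>\<^sub>F i in sequentially. P i" for P :: "nat \<Rightarrow> bool"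
      using that unfolding eventually_sequentially infinite_nat_iff_unbounded_le
      by (metis le_cases mem_Collect_eq)
    then show ?thesis
      using q topspace_eq unfolding positive_upper_independence_density_def by auto
  qed
  then show "sofic_IE_tuples G T d \<alpha> n \<sigma> k = ({1..k} \<rightarrow>\<^sub>E topspace T)"
    by (auto simp: sofic_IE_tuples_def)
qed

text \<open>Maps realizing different patterns on \<open>J\<close> differ by at least
  \<open>r\<close> at some vertex of \<open>J\<close>, so at scale \<open>r\<close> there are
  \<open>2 ^ card J\<close> separated maps for every \<open>F\<close> and \<open>\<delta>\<close>,
  eventually in \<open>i\<close>.\<close>

lemma sofic_entropy_pos:
  assumes sofic: "sofic_approximation G n \<sigma>" and "homoclinic \<noteq> {\<one>}"
  shows "sofic_entropy G (carrier X) d \<alpha> n \<sigma> > 0"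
proof -
  obtain p r where p: "\<And>j. j \<in> {1..2::nat} \<Longrightarrow> p j \<in> homoclinic" "r > 0"
    "\<And>y z. y \<in> mcball (p 1) r \<Longrightarrow> z \<in> mcball (p 2) r \<Longrightarrow> r \<le> d y z"
    using homoclinic_pair[OF assms(2)] by blast
  define A where "A j = mcball (p j) r" for j
  have far: "r \<le> d y z" if "y \<in> A i" "z \<in> A j" "i \<in> {1..2}" "j \<in> {1..2}" "i \<noteq> j" for y z i j
  proof -
    have "i = 1 \<and> j = 2 \<or> i = 2 \<and> j = 1"
      using that by auto
    then show ?thesis
      using that p(3)[of y z] p(3)[of z y] by (auto simp: A_def commute)
  qed
  have "\<And>j. j \<in> {1..2} \<Longrightarrow> mball (p j) r \<subseteq> A j"
    by (auto simp: A_def mball_subset_mcball)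
  then obtain q where q: "q > 0" "\<And>F \<delta>. finite F \<Longrightarrow> F \<subseteq> carrier G \<Longrightarrow> \<delta> > 0 \<Longrightarrow>
      \<forall>\<^sub>F i in sequentially. \<exists>J. sofic_independence_set (carrier X) d \<alpha> F \<delta> (n i) (\<sigma> i) 2 A J \<and>
        q * real (n i) \<le> real (card J)"
    using sofic_independence[where k = 2 and x = p and A = A, OF sofic p(1,2)] by blast
  have rate: "ereal (q * ln 2) \<le>
      log_card (max_separated_card d m r (sofic_maps (carrier X) d \<alpha> F \<delta> m \<tau>)) / ereal (real m)"
    if J: "sofic_independence_set (carrier X) d \<alpha> F \<delta> m \<tau> 2 A J" "q * real m \<le> real (card J)"
      and "m > 0" for F \<delta> m \<tau> J
  proof -
    define Y where "Y = sofic_maps (carrier X) d \<alpha> F \<delta> m \<tau>"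
    have Jm: "J \<subseteq> {1..m}" "finite J"
      using J(1) by (auto simp: sofic_independence_set_def intro: finite_subset)
    have "\<exists>\<phi>\<in>Y. \<forall>a\<in>J. \<phi> a \<in> A (\<omega> a)" if "\<omega> \<in> J \<rightarrow>\<^sub>E {1..2}" for \<omega>
    proof -
      have "\<omega> \<in> J \<rightarrow> {1..2}"
        using that by (simp add: PiE_def)
      then show ?thesis
        using J(1) unfolding sofic_independence_set_def Y_def by blast
    qed
    then obtain \<Phi> where \<Phi>: "\<And>\<omega>. \<omega> \<in> J \<rightarrow>\<^sub>E {1..2} \<Longrightarrow> \<Phi> \<omega> \<in> Y"
      "\<And>\<omega> a. \<omega> \<in> J \<rightarrow>\<^sub>E {1..2} \<Longrightarrow> a \<in> J \<Longrightarrow> \<Phi> \<omega> a \<in> A (\<omega> a)"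
      by metis
    have sep: "\<exists>v\<in>{1..m}. r \<le> d (\<Phi> \<omega> v) (\<Phi> \<omega>' v)"
      if \<omega>: "\<omega> \<in> J \<rightarrow>\<^sub>E {1..2}" "\<omega>' \<in> J \<rightarrow>\<^sub>E {1..2}" "\<omega> \<noteq> \<omega>'" for \<omega> \<omega>'
    proof -
      obtain a where a: "a \<in> J" "\<omega> a \<noteq> \<omega>' a"
        using PiE_ext[OF \<omega>(1,2)] \<omega>(3) by blast
      then have "r \<le> d (\<Phi> \<omega> a) (\<Phi> \<omega>' a)"
        using \<omega> by (intro far[of _ "\<omega> a" _ "\<omega>' a"] \<Phi>(2)) (auto dest: PiE_mem)
      then show ?thesis
        using a(1) Jm(1) by blast
    qed
    have YX: "Y \<subseteq> {1..m} \<rightarrow>\<^sub>E carrier X"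
      by (auto simp: Y_def sofic_maps_def)
    have "inj_on \<Phi> (J \<rightarrow>\<^sub>E {1..2})"
    proof (rule inj_onI, rule ccontr)
      fix \<omega> \<omega>' assume \<omega>: "\<omega> \<in> J \<rightarrow>\<^sub>E {1..2}" "\<omega>' \<in> J \<rightarrow>\<^sub>E {1..2}" "\<Phi> \<omega> = \<Phi> \<omega>'" "\<omega> \<noteq> \<omega>'"
      then obtain v where v: "v \<in> {1..m}" "r \<le> d (\<Phi> \<omega> v) (\<Phi> \<omega> v)"
        using sep[OF \<omega>(1,2,4)] by auto
      have "\<Phi> \<omega> v \<in> carrier X"
        using \<Phi>(1)[OF \<omega>(1)] YX v(1) by blast
      then show False
        using v(2) p(2) by simp
    qed
    then have "card (\<Phi> ` (J \<rightarrow>\<^sub>E {1..2})) = 2 ^ card J"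
      using Jm(2) by (simp add: card_image card_funcsetE)
    moreover have "card (\<Phi> ` (J \<rightarrow>\<^sub>E {1..2})) \<le> max_separated_card d m r Y"
    proof (rule max_separated_card_ge[OF _ _ YX \<open>m > 0\<close> p(2)])
      show "\<exists>v\<in>{1..m}. r \<le> d (\<phi> v) (\<psi> v)"
        if "\<phi> \<in> \<Phi> ` (J \<rightarrow>\<^sub>E {1..2})" "\<psi> \<in> \<Phi> ` (J \<rightarrow>\<^sub>E {1..2})" "\<phi> \<noteq> \<psi>" for \<phi> \<psi>
        using that sep by blast
    qed (use \<Phi>(1) Jm(2) in \<open>auto intro: finite_PiE\<close>)
    ultimately have le: "2 ^ card J \<le> max_separated_card d m r Y"
      by simp
    \<comment> \<open>This excludes the value \<open>-\<infinity>\<close> of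
      \<open>log_card\<close>.\<close>
    then have "max_separated_card d m r Y \<noteq> 0"
      by (metis le_zero_eq power_not_zero zero_neq_numeral)
    then show ?thesis
      using ln_rate_of_exponential[OF le J(2) \<open>m > 0\<close>] \<open>m > 0\<close>
      by (simp add: log_card_def Y_def)
  qed
  have pos: "\<forall>\<^sub>F i in sequentially. n i > 0"
    using sofic unfolding sofic_approximation_def filterlim_at_top
    by (auto elim: allE[of _ 1] simp: Suc_le_eq)
  have "ereal (q * ln 2) \<le> limsup (\<lambda>i. log_card (max_separated_card d (n i) r
      (sofic_maps (carrier X) d \<alpha> F \<delta> (n i) (\<sigma> i))) / ereal (real (n i)))"
    if F: "finite F" "F \<subseteq> carrier G" "\<delta> > 0" for F \<delta>
  proof (rule le_Limsup)
    show "\<forall>\<^sub>F i in sequentially. ereal (q * ln 2) \<le> log_card (max_separated_card d (n i) r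
      (sofic_maps (carrier X) d \<alpha> F \<delta> (n i) (\<sigma> i))) / ereal (real (n i))"
      using q(2)[OF F] pos
    proof eventually_elim
      case (elim i)
      then obtain J where "sofic_independence_set (carrier X) d \<alpha> F \<delta> (n i) (\<sigma> i) 2 A J"
        "q * real (n i) \<le> real (card J)"
        by blast
      then show ?case
        using elim(2) by (rule rate)
    qed
  qed simp
  then have "ereal (q * ln 2) \<le> sofic_entropy G (carrier X) d \<alpha> n \<sigma>"
    unfolding sofic_entropy_def using p(2)
    by (intro SUP_upper2[of r] INF_greatest) auto
  moreover have "0 < ereal (q * ln 2)"
    using q(1) by simp
  ultimately show ?thesis
    by (rule order.strict_trans2[rotated])
qed

end

theorem corollary7p3:
  fixes G :: "('g, 'm) monoid_scheme" and X :: "('x, 'n) monoid_scheme"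
    and T :: "'x topology" and d :: "'x \<Rightarrow> 'x \<Rightarrow> real" and \<alpha> :: "'g \<Rightarrow> 'x \<Rightarrow> 'x"
  assumes action: "automorphism_action G X T \<alpha>"
    and compact: "compact_space T"
    and metric: "Metric_space (carrier X) d"
    and compatible: "Metric_space.mtopology (carrier X) d = T"
    and countable: "countable (carrier G)"
    and infinite: "infinite (carrier G)"
    and expansive: "expansive G (carrier X) d \<alpha>"
  shows "(homoclinic_group G X T \<alpha> \<noteq> {\<one>\<^bsub>X\<^esub>} \<longrightarrow> naive_entropy G T \<alpha> > 0) \<and>
    (T closure_of (homoclinic_group G X T \<alpha>) = carrier X \<longrightarrow> naive_UPE_all_orders G T \<alpha>) \<and>
    (\<forall>n \<sigma>. sofic_approximation G n \<sigma> \<longrightarrow>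
      (homoclinic_group G X T \<alpha> \<noteq> {\<one>\<^bsub>X\<^esub>} \<longrightarrow>
         sofic_entropy G (carrier X) d \<alpha> n \<sigma> > 0) \<and>
      (T closure_of (homoclinic_group G X T \<alpha>) = carrier X \<longrightarrow>
         sofic_UPE_all_orders G T d \<alpha> n \<sigma>))"
proof -
  obtain c where "c > 0"
    "\<forall>x\<in>carrier X. \<forall>y\<in>carrier X. x \<noteq> y \<longrightarrow> (\<exists>g\<in>carrier G. d (\<alpha> g x) (\<alpha> g y) > c)"
    using expansive unfolding expansive_def by blast
  then interpret expansive_compact_action G X T \<alpha> d c
    using action metric compact compatible
    by (intro expansive_compact_action.intro expansive_compact_action_axioms.intro) auto
  show ?thesis
    using naive_entropy_pos naive_UPE sofic_entropy_pos sofic_UPE by blast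
qed

end
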